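(* Consider the sequence of scaled state-control models of the context (base rates $\lambda_i,\mu_i$, $\rho_i=\lambda_i/\mu_i$, target polytope $\mathcal S=\{\mathbf x:\mathbf 0\le\mathbf x\le\boldsymbol\rho,\ \mathbf D\mathbf x\le\mathbf h\}$ with $\mathbf D\in\mathbf R^{s\times m}$, $\mathbf h\in\mathbf R_+^s$) under the penalty policy $\tilde{\boldsymbol\pi}$ with multiplier $\beta$, and assume $\mu_{\min}/\mu_{\max}\ge\gamma^*$, where $\mu_{\min}=\min_{1\le i\le m}\mu_i$ and $\mu_{\max}=\max_{1\le i\le m}\mu_i$. Fix $0<\varepsilon<\frac14$, $\beta\ge\frac1\varepsilon\log(s)$, and $\tilde{\mathbf y}(0^-)$ such that $\Psi(\mathbf 0,\tilde{\mathbf y}(0^-))\le\Psi^*$. Then, for all $t\ge0$, $$\tilde{\mathbf x}^{(\infty)}(t)\in\tilde{\mathcal S}_\varepsilon(t)=\Big\{\mathbf x:\mathbf 0\le\mathbf x\le\boldsymbol\rho,\ \mathbf D\mathbf x\le\mathbf h+4\varepsilon(\mathbf h+\mathbf D^-\boldsymbol\rho)+\mathbf D^-e^{-\mathbf Mt}(\boldsymbol\rho-\tilde{\mathbf y}(0^-))\Big\},$$ where $\mathbf M=\mathrm{diag}(\mu_1,\dots,\mu_m)$.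
   Context: State-control model. Requests of $m$ classes arrive in independent Poisson streams to a common infinite-capacity system; class $i$ service durations are $\exp(\mu_i)$. Each arriving request is accepted or rejected on arrival; the system is initially empty. $\boldsymbol\rho=(\rho_1,\dots,\rho_m)^T$. The interior of $\mathcal S$ is assumed nonempty, in the sense that there is $\mathbf x\in\mathcal S$ with $\mathbf D\mathbf x<\mathbf h$ (componentwise). Write $\mathbf D^+,\mathbf D^-$ for the matrices with entries $\max\{D_{ji},0\}$ and $\max\{-D_{ji},0\}$, with $j$th rows $\mathbf d_j^+,\mathbf d_j^-$. The lifted set is $$\tilde{\mathcal S}=\{(\mathbf x,\mathbf y):\mathbf 0\le\mathbf x\le\boldsymbol\rho,\ \mathbf 0\le\mathbf y\le\boldsymbol\rho,\ \mathbf D^+\mathbf x+\mathbf D^-\mathbf y\le\mathbf h+\mathbf D^-\boldsymbol\rho\}.$$ Define $$(\mathbf x^*,\mathbf y^* )=\arg\min_{(\mathbf x,\mathbf y)\in\tilde{\mathcal S}}\ \max_{1\le j\le s}\Big\{\frac{\mathbf d_j^+\mathbf x+\mathbf d_j^-\mathbf y}{h_j+\mathbf d_j^-\boldsymbol\rho}\Big\},$$ and let $\gamma^*$ be the minimum value. The penalty function is $$\Psi(\mathbf x,\mathbf y)=\sum_{j=1}^s\exp\Big(\beta\cdot\frac{\mathbf d_j^+\mathbf x+\mathbf d_j^-\mathbf y}{h_j+\mathbf d_j^-\boldsymbol\rho}\Big),\qquad\Psi^*=\Psi\Big(\frac{(1+3\varepsilon)\mu_{\max}}{\mu_{\min}}(\mathbf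 x^*,\mathbf y^* )\Big).$$ Scaled models and policy $\tilde{\boldsymbol\pi}$. In the $n$th model, class $i$ has arrival rate $n\lambda_i$ and service rate $\mu_i$. A fictitious infinite-capacity system tracks rejected requests. Let $\tilde{\mathbf s}^{(n)}(t)=(\tilde{\mathbf x}^{(n)}(t),\tilde{\mathbf y}^{(n)}(t))$ be the numbers of requests of each class in the original and fictitious systems divided by $n$. At time $0^-$, $\tilde{\mathbf x}^{(n)}=\mathbf 0$ and $\tilde{\mathbf y}^{(n)}(0^-)=\tilde{\mathbf y}(0^-)$, the initial fictitious requests having $\exp(\mu_i)$ service times. An arriving class $i$ request is accepted if $\frac{\partial\Psi}{\partial x_i}\le\frac{\partial\Psi}{\partial y_i}$ at the current normalized state $\tilde{\mathbf s}^{(n)}$; otherwise it is routed to the fictitious system with an $\exp(\mu_i)$ service time independent of everything else. The models are built by driving arrivals and departures of each class in each of the two systems with independent rate-1 Poisson processes run at the corresponding cumulative intensities. $\tilde{\mathbf s}^{(\infty)}(t)=(\tilde{\mathbf x}^{(\infty)}(t),\tilde{\mathbf y}^{(\infty)}(t))=\lim_{n\to\infty}\tilde{\mathbf s}^{(n)}(t)$ denotes the limit, which exists and is nonrandom.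
   Formalization: The minimum defining (x*,y* ) and γ* is taken over points of the lifted set with x + y = ρ (otherwise (0,0) is always a minimizer, γ* = 0, and the claim is false), and β > 0 is assumed (this matters only for s = 1, β = 0, where the claim fails). *)

theory Defs
  imports "HOL-Probability.Probability"
begin

text \<open>Vectors and matrices are indexed by finite types: \<open>'m\<close> for the request classes and
  \<open>'s\<close> for the rows of the constraint matrix. The order on \<open>real ^ 'm\<close> is componentwise.\<close>

definition pos_mat :: "real ^ 'm ^ 's \<Rightarrow> real ^ 'm ^ 's"
  where "pos_mat D = (\<chi> j i. max (D $ j $ i) 0)"

definition neg_mat :: "real ^ 'm ^ 's \<Rightarrow> real ^ 'm ^ 's"
  where "neg_mat D = (\<chi> j i. max (- D $ j $ i) 0)"

definition target_polytope ::
  "real ^ 'm ^ 's \<Rightarrow> real ^ 's \<Rightarrow> real ^ 'm \<Rightarrow> (real ^ 'm::finite) set"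
  where "target_polytope D h \<rho> = {x. 0 \<le> x \<and> x \<le> \<rho> \<and> D *v x \<le> h}"

definition lifted_set ::
  "real ^ 'm ^ 's \<Rightarrow> real ^ 's \<Rightarrow> real ^ 'm \<Rightarrow> ((real ^ 'm) \<times> (real ^ 'm::finite)) set"
  where "lifted_set D h \<rho> = {(x, y). 0 \<le> x \<and> x \<le> \<rho> \<and> 0 \<le> y \<and> y \<le> \<rho> \<and>
    pos_mat D *v x + neg_mat D *v y \<le> h + neg_mat D *v \<rho>}"

definition norm_load ::
  "real ^ 'm ^ 's \<Rightarrow> real ^ 's \<Rightarrow> real ^ 'm \<Rightarrow> 's \<Rightarrow> real ^ 'm \<Rightarrow> real ^ 'm::finite \<Rightarrow> real"
  where "norm_load D h \<rho> j x y =
    ((pos_mat D *v x) $ j + (neg_mat D *v y) $ j) / (h $ j + (neg_mat D *v \<rho>) $ j)"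

definition max_load ::
  "real ^ 'm ^ 's::finite \<Rightarrow> real ^ 's \<Rightarrow> real ^ 'm \<Rightarrow> (real ^ 'm) \<times> (real ^ 'm::finite) \<Rightarrow> real"
  where "max_load D h \<rho> p = (MAX j\<in>UNIV. norm_load D h \<rho> j (fst p) (snd p))"

text \<open>The minimum is taken over the graph of \<open>x \<mapsto> (x, \<rho> - x)\<close> in the lifted set, since rejected
  requests are exactly those in the fictitious system. Without \<open>x + y = \<rho>\<close> the point \<open>(0, 0)\<close>
  would always be a minimizer, with value 0, because \<open>h \<ge> 0\<close>.\<close>

definition lifted_minimizer ::
  "real ^ 'm ^ 's::finite \<Rightarrow> real ^ 's \<Rightarrow> real ^ 'm \<Rightarrow> (real ^ 'm) \<times> (real ^ 'm::finite) \<Rightarrow> bool"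
  where "lifted_minimizer D h \<rho> =
    is_arg_min (max_load D h \<rho>) (\<lambda>(x, y). (x, y) \<in> lifted_set D h \<rho> \<and> x + y = \<rho>)"

definition penalty ::
  "real \<Rightarrow> real ^ 'm ^ 's::finite \<Rightarrow> real ^ 's \<Rightarrow> real ^ 'm \<Rightarrow> real ^ 'm \<Rightarrow> real ^ 'm::finite \<Rightarrow> real"
  where "penalty \<beta> D h \<rho> x y = (\<Sum>j\<in>UNIV. exp (\<beta> * norm_load D h \<rho> j x y))"

definition partial_x ::
  "(real ^ 'm \<Rightarrow> real ^ 'm \<Rightarrow> real) \<Rightarrow> 'm::finite \<Rightarrow> real ^ 'm \<Rightarrow> real ^ 'm \<Rightarrow> real"
  where "partial_x F i x y = deriv (\<lambda>u. F (x + u *\<^sub>R axis i 1) y) 0"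

definition partial_y ::
  "(real ^ 'm \<Rightarrow> real ^ 'm \<Rightarrow> real) \<Rightarrow> 'm::finite \<Rightarrow> real ^ 'm \<Rightarrow> real ^ 'm \<Rightarrow> real"
  where "partial_y F i x y = deriv (\<lambda>u. F x (y + u *\<^sub>R axis i 1)) 0"

primrec mat_power :: "real ^ 'm ^ 'm::finite \<Rightarrow> nat \<Rightarrow> real ^ 'm ^ 'm"
  where
    "mat_power A 0 = mat 1"
  | "mat_power A (Suc k) = A ** mat_power A k"

definition mat_exp :: "real ^ 'm ^ 'm::finite \<Rightarrow> real ^ 'm ^ 'm"
  where "mat_exp A = (\<Sum>k. (1 / fact k) *\<^sub>R mat_power A k)"

definition diag_mat :: "real ^ 'm::finite \<Rightarrow> real ^ 'm ^ 'm"
  where "diag_mat v = (\<chi> i j. if i = j then v $ i else 0)"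

definition relaxed_set ::
  "real ^ 'm ^ 's \<Rightarrow> real ^ 's \<Rightarrow> real ^ 'm \<Rightarrow> real ^ 'm \<Rightarrow> real \<Rightarrow> real ^ 'm \<Rightarrow> real \<Rightarrow> (real ^ 'm::finite) set"
  where "relaxed_set D h \<rho> \<mu> \<epsilon> y0 t = {x. 0 \<le> x \<and> x \<le> \<rho> \<and>
    D *v x \<le> h + (4 * \<epsilon>) *\<^sub>R (h + neg_mat D *v \<rho>)
      + neg_mat D *v (mat_exp (- t *\<^sub>R diag_mat \<mu>) *v (\<rho> - y0))}"

definition (in prob_space) unit_poisson_process :: "(real \<Rightarrow> 'a \<Rightarrow> nat) \<Rightarrow> bool"
  where "unit_poisson_process N \<longleftrightarrow>
    (\<forall>t\<ge>0. N t \<in> M \<rightarrow>\<^sub>M count_space UNIV) \<and>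
    (\<forall>\<omega>\<in>space M. N 0 \<omega> = 0 \<and> mono_on {0..} (\<lambda>t. N t \<omega>) \<and>
      (\<forall>t\<ge>0. continuous (at_right t) (\<lambda>u. N u \<omega>))) \<and>
    (\<forall>s t. 0 \<le> s \<and> s < t \<longrightarrow>
      distr M (count_space UNIV) (\<lambda>\<omega>. N t \<omega> - N s \<omega>) = measure_pmf (poisson_pmf (t - s))) \<and>
    (\<forall>(\<tau> :: nat \<Rightarrow> real) k. 0 \<le> \<tau> 0 \<and> mono \<tau> \<longrightarrow>
      indep_vars (\<lambda>_. count_space UNIV) (\<lambda>l \<omega>. N (\<tau> (Suc l)) \<omega> - N (\<tau> l) \<omega>) {..<k})"

datatype system = Original | Fictitious
datatype event = Arrival | Departure

definition (in prob_space) indep_unit_poisson_family ::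
  "(system \<times> event \<times> 'm::finite \<Rightarrow> real \<Rightarrow> 'a \<Rightarrow> nat) \<Rightarrow> bool"
  where "indep_unit_poisson_family N \<longleftrightarrow>
    (\<forall>c. unit_poisson_process (N c)) \<and>
    indep_vars (\<lambda>_. PiM {0..} (\<lambda>_. count_space UNIV)) (\<lambda>c \<omega>. \<lambda>t\<in>{0..}. N c t \<omega>) UNIV"

definition scale_state :: "nat \<Rightarrow> nat ^ 'm::finite \<Rightarrow> real ^ 'm"
  where "scale_state n v = (\<chi> i. real (v $ i) / real n)"

definition accepts ::
  "real \<Rightarrow> real ^ 'm ^ 's::finite \<Rightarrow> real ^ 's \<Rightarrow> real ^ 'm \<Rightarrow> 'm::finite \<Rightarrow> real ^ 'm \<Rightarrow> real ^ 'm \<Rightarrow> bool"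
  where "accepts \<beta> D h \<rho> i x y \<longleftrightarrow>
    partial_x (penalty \<beta> D h \<rho>) i x y \<le> partial_y (penalty \<beta> D h \<rho>) i x y"

text \<open>One sample path of the \<open>n\<close>th model under the penalty policy: \<open>X\<close> and \<open>Y\<close> are the unscaled
  request counts in the original and the fictitious system, \<open>k\<close> the initial fictitious requests and
  \<open>P\<close> the path of the driving unit-rate processes. Each count is the time-changed arrivals minus
  the time-changed departures (moved to the left-hand side, since the counts are natural numbers).
  The offered load \<open>\<lambda>\<^sub>i/\<mu>\<^sub>i\<close> of the base model enters through the policy.\<close>

definition model_path ::
  "real \<Rightarrow> real ^ 'm ^ 's::finite \<Rightarrow> real ^ 's \<Rightarrow> real ^ 'm \<Rightarrow> real ^ 'm \<Rightarrow> real ^ 'm \<Rightarrow> nat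
    \<Rightarrow> nat ^ 'm \<Rightarrow> (system \<times> event \<times> 'm::finite \<Rightarrow> real \<Rightarrow> nat)
    \<Rightarrow> (real \<Rightarrow> nat ^ 'm) \<Rightarrow> (real \<Rightarrow> nat ^ 'm) \<Rightarrow> bool"
  where "model_path \<beta> D h \<rho> lam \<mu> n k P X Y \<longleftrightarrow>
    (\<forall>t\<ge>0. \<forall>i.
      let acc = (\<lambda>u. of_bool (accepts \<beta> D h \<rho> i (scale_state n (X u)) (scale_state n (Y u))) :: real);
          xi = (\<lambda>u. real (X u $ i));
          yi = (\<lambda>u. real (Y u $ i))
      in acc integrable_on {0..t} \<and> xi integrable_on {0..t} \<and> yi integrable_on {0..t} \<and>
         X t $ i + P (Original, Departure, i) (integral {0..t} (\<lambda>u. \<mu> $ i * xi u)) =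
           P (Original, Arrival, i) (integral {0..t} (\<lambda>u. real n * lam $ i * acc u)) \<and>
         Y t $ i + P (Fictitious, Departure, i) (integral {0..t} (\<lambda>u. \<mu> $ i * yi u)) =
           k $ i + P (Fictitious, Arrival, i) (integral {0..t} (\<lambda>u. real n * lam $ i * (1 - acc u))))"

end

theory Submission
  imports Defs
begin

text \<open>
  The random models are replaced by their deterministic fluid limit, and the penalty function is a
  Lyapunov function for that limit.

  Fluid limit. A rate-one Poisson path satisfies \<open>\<bar>N t - t\<bar> \<le> \<eta> t + C\<close> almost surely, for every
  \<open>\<eta> > 0\<close> and some random \<open>C\<close> (\<open>AE_asymptotically_linear\<close>). Consequently the scaled queue lengths are
  Lipschitz up to a vanishing error, with a constant that does not depend on the outcome
  (\<open>eventually_increment\<close>). The given limits hold almost surely at each fixed time; the Lipschitz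
  property allows fixing a single outcome with convergence at all rational times and deducing
  convergence at all times (\<open>limit_from_rationals\<close>). The time spent accepting each class then converges
  too, and the limit is a trajectory of a differential inclusion: class \<open>i\<close> enters the original system
  where \<open>\<partial>\<Psi>/\<partial>x\<^sub>i < \<partial>\<Psi>/\<partial>y\<^sub>i\<close>, the fictitious one where the reverse inequality holds, and is split
  arbitrarily where equality holds (\<open>fluid_limit_is_trajectory\<close>).

  Lyapunov bound. Along a trajectory the penalty changes at rate
  \<open>\<Sum>\<^sub>i \<lambda>\<^sub>i min (\<partial>\<Psi>/\<partial>x\<^sub>i) (\<partial>\<Psi>/\<partial>y\<^sub>i) - \<mu>\<^sub>i (x\<^sub>i \<partial>\<Psi>/\<partial>x\<^sub>i + y\<^sub>i \<partial>\<Psi>/\<partial>y\<^sub>i)\<close>. Since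
  \<open>x\<^sup>* + y\<^sup>* = \<rho>\<close>, the minimum times \<open>\<rho>\<^sub>i\<close> is at most \<open>x\<^sup>*\<^sub>i \<partial>\<Psi>/\<partial>x\<^sub>i + y\<^sup>*\<^sub>i \<partial>\<Psi>/\<partial>y\<^sub>i\<close>, and convexity bounds
  the rate by \<open>\<mu>\<^sub>m\<^sub>i\<^sub>n (\<Psi> (c x\<^sup>*, c y\<^sup>*) - \<Psi> (x, y))\<close> with \<open>c = \<mu>\<^sub>m\<^sub>a\<^sub>x/\<mu>\<^sub>m\<^sub>i\<^sub>n\<close> (\<open>drift_negative\<close>). So the penalty
  decreases whenever it exceeds \<open>\<Psi> (c x\<^sup>*, c y\<^sup>*)\<close>, which is at most \<open>\<Psi>\<^sup>*\<close>, and it can never cross \<open>\<Psi>\<^sup>*\<close>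
  (\<open>penalty_bounded\<close>).

  Conclusion. By \<open>c \<gamma>\<^sup>* \<le> 1\<close> all loads at \<open>(1 + 3 \<epsilon>) c (x\<^sup>*, y\<^sup>*)\<close> are at most \<open>1 + 3 \<epsilon>\<close>, and a bound on a
  sum of exponentials bounds each load up to \<open>ln s/\<beta> \<le> \<epsilon>\<close>; hence all loads of the limit are at most
  \<open>1 + 4 \<epsilon>\<close>. The total \<open>x + y\<close> does not depend on the policy and equals \<open>\<rho> - exp (- M t) (\<rho> - y0)\<close>
  (\<open>total_eq\<close>), which turns this bound on \<open>D\<^sup>+ x + D\<^sup>- y\<close> into the asserted bound on
  \<open>D x = D\<^sup>+ x + D\<^sup>- y - D\<^sup>- (x + y)\<close>.
\<close>

section \<open>A strong law for Poisson paths\<close>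

text \<open>A pathwise law of large numbers with explicit error. The error is allowed to grow
  linearly with an arbitrarily small slope, so that it vanishes uniformly on bounded intervals
  after scaling time and space by \<open>n\<close>.\<close>

definition asymptotically_linear :: "(real \<Rightarrow> nat) \<Rightarrow> bool"
  where "asymptotically_linear p \<longleftrightarrow>
    mono_on {0..} p \<and> (\<forall>\<eta>>0. \<exists>C. \<forall>t\<ge>0. \<bar>real (p t) - t\<bar> \<le> \<eta> * t + C)"

text \<open>For negative arguments the bound is the reciprocal of \<open>exp y \<ge> 1 + y\<close>, because
  \<open>(1 + y) * (1 - y + y\<^sup>2) = 1 + y\<^sup>3\<close>.\<close>

lemma exp_le_quadratic:
  fixes x :: real
  assumes "\<bar>x\<bar> \<le> 1"
  shows "exp x \<le> 1 + x + x\<^sup>2"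
proof (cases "0 \<le> x")
  case True
  with assms show ?thesis using exp_bound[of x] by simp
next
  case False
  define y where "y = - x"
  have y: "0 < y" "y \<le> 1" using False assms by (auto simp: y_def)
  have "1 \<le> (1 + y) * (1 - y + y\<^sup>2)"
    using y by (simp add: algebra_simps power2_eq_square)
  also have "\<dots> \<le> exp y * (1 - y + y\<^sup>2)"
    using y by (intro mult_right_mono) auto
  finally have "inverse (exp y) \<le> 1 - y + y\<^sup>2"
    by (simp add: field_simps)
  then show ?thesis by (simp add: y_def exp_minus)
qed

lemma nn_integral_exp_poisson:
  assumes r: "0 < r"
  shows "(\<integral>\<^sup>+ k. ennreal (exp (\<theta> * real k)) \<partial>measure_pmf (poisson_pmf r)) = ennreal (exp (r * (exp \<theta> - 1)))"
proof -
  have s: "(\<lambda>k. exp (- r) * ((r * exp \<theta>) ^ k / fact k)) sums (exp (- r) * exp (r * exp \<theta>))"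
    by (intro sums_mult) (use exp_converges[of "r * exp \<theta>"] in \<open>simp add: scaleR_conv_of_real field_simps\<close>)
  have "(\<integral>\<^sup>+ k. ennreal (exp (\<theta> * real k)) \<partial>measure_pmf (poisson_pmf r))
      = (\<Sum>k. ennreal (exp (- r) * ((r * exp \<theta>) ^ k / fact k)))"
    unfolding nn_integral_measure_pmf nn_integral_count_space_nat
    using r by (intro suminf_cong)
      (simp add: ennreal_mult[symmetric] power_mult_distrib exp_of_nat_mult[symmetric] mult_ac
        flip: exp_of_nat_mult)
  also have "\<dots> = ennreal (exp (- r) * exp (r * exp \<theta>))"
    using r by (intro suminf_ennreal_eq s) auto
  finally show ?thesis by (simp add: exp_add[symmetric] algebra_simps flip: exp_add)
qed

text \<open>The random variables \<open>exp (\<theta> (\<sigma> (N\<^sub>k - k) - \<eta> k))\<close> with \<open>\<theta> = \<eta>/2\<close> have geometrically decreasing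
  expectations, by the moment generating function of the Poisson law. Hence their sum over \<open>k\<close> is
  almost surely finite, and a bound \<open>S\<close> of the sum bounds every term, which leaves the additive
  constant \<open>ln S/\<theta>\<close> in the exponent. The sign \<open>\<sigma>\<close> selects upper or lower deviations.\<close>

lemma (in prob_space) AE_unit_poisson_deviation:
  fixes \<eta> \<sigma> :: real
  assumes P: "unit_poisson_process P" and \<eta>: "0 < \<eta>" "\<eta> \<le> 1"
    and \<sigma>: "\<bar>\<sigma>\<bar> = 1"
  shows "AE \<omega> in M. \<exists>C. \<forall>k::nat. \<sigma> * (real (P (real k) \<omega>) - k) \<le> \<eta> * k + C"
proof -
  define \<theta> where "\<theta> = \<eta> / 2"
  define Z where "Z k \<omega> = exp (\<theta> * (\<sigma> * (real (P (real k) \<omega>) - k) - \<eta> * k))" for k :: nat and \<omega>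
  have \<theta>: "0 < \<theta>" "\<theta> \<le> 1" using \<eta> by (auto simp: \<theta>_def)
  have \<sigma>2: "\<sigma> * \<sigma> = 1" using \<sigma> by (auto simp: abs_if split: if_splits)
  have [measurable]: "P (real k) \<in> M \<rightarrow>\<^sub>M count_space UNIV" for k :: nat
    using P by (auto simp: unit_poisson_process_def)
  have Zm[measurable]: "Z k \<in> borel_measurable M" for k
    unfolding Z_def by measurable
  define q where "q = exp (- \<eta>\<^sup>2 / 4)"
  have q: "0 < q" "q < 1" using \<eta> by (auto simp: q_def)
  have bound: "(\<integral>\<^sup>+ \<omega>. ennreal (Z k \<omega>) \<partial>M) \<le> ennreal (q ^ k)" for k
  proof (cases "k = 0")
    case True
    have "P 0 \<omega> = 0" if "\<omega> \<in> space M" for \<omega> using P that by (auto simp: unit_poisson_process_def)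
    then have "(\<integral>\<^sup>+ \<omega>. ennreal (Z k \<omega>) \<partial>M) = (\<integral>\<^sup>+ \<omega>. 1 \<partial>M)"
      using True by (intro nn_integral_cong) (auto simp: Z_def)
    then show ?thesis using True by (simp add: emeasure_space_1)
  next
    case False
    have "distr M (count_space UNIV) (\<lambda>\<omega>. P (real k) \<omega> - P 0 \<omega>) = measure_pmf (poisson_pmf (real k - 0))"
      using P False unfolding unit_poisson_process_def by auto
    moreover have "distr M (count_space UNIV) (\<lambda>\<omega>. P (real k) \<omega> - P 0 \<omega>) = distr M (count_space UNIV) (P (real k))"
      using P by (intro distr_cong) (auto simp: unit_poisson_process_def)
    ultimately have d: "distr M (count_space UNIV) (P (real k)) = measure_pmf (poisson_pmf (real k))"
      by simp
    have "(\<integral>\<^sup>+ \<omega>. ennreal (Z k \<omega>) \<partial>M)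
        = (\<integral>\<^sup>+ \<omega>. ennreal (exp (- \<theta> * (\<sigma> + \<eta>) * k)) * ennreal (exp ((\<theta> * \<sigma>) * real (P (real k) \<omega>))) \<partial>M)"
      unfolding Z_def by (intro nn_integral_cong)
        (simp add: ennreal_mult[symmetric] exp_add[symmetric] algebra_simps flip: exp_add)
    also have "\<dots> = ennreal (exp (- \<theta> * (\<sigma> + \<eta>) * k)) * (\<integral>\<^sup>+ \<omega>. ennreal (exp ((\<theta> * \<sigma>) * real (P (real k) \<omega>))) \<partial>M)"
      by (intro nn_integral_cmult) measurable
    also have "(\<integral>\<^sup>+ \<omega>. ennreal (exp ((\<theta> * \<sigma>) * real (P (real k) \<omega>))) \<partial>M)
        = (\<integral>\<^sup>+ i. ennreal (exp ((\<theta> * \<sigma>) * real i)) \<partial>measure_pmf (poisson_pmf (real k)))"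
      by (subst d[symmetric], subst nn_integral_distr) auto
    also have "\<dots> = ennreal (exp (k * (exp (\<theta> * \<sigma>) - 1)))"
      using False by (intro nn_integral_exp_poisson) simp
    also have "ennreal (exp (- \<theta> * (\<sigma> + \<eta>) * k)) * \<dots> = ennreal (exp (k * (exp (\<theta> * \<sigma>) - 1 - \<theta> * \<sigma> - \<theta> * \<eta>)))"
      by (simp add: ennreal_mult[symmetric] exp_add[symmetric] algebra_simps flip: exp_add)
    also have "\<dots> \<le> ennreal (exp (k * (- \<eta>\<^sup>2 / 4)))"
    proof -
      have "exp (\<theta> * \<sigma>) \<le> 1 + \<theta> * \<sigma> + (\<theta> * \<sigma>)\<^sup>2"
        using \<theta> \<sigma> by (intro exp_le_quadratic) (simp add: abs_mult)
      also have "(\<theta> * \<sigma>)\<^sup>2 = \<theta>\<^sup>2" using \<sigma>2 by (simp add: power2_eq_square algebra_simps)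
      finally have "exp (\<theta> * \<sigma>) - 1 - \<theta> * \<sigma> - \<theta> * \<eta> \<le> - \<eta>\<^sup>2 / 4"
        by (simp add: \<theta>_def power2_eq_square)
      then have "k * (exp (\<theta> * \<sigma>) - 1 - \<theta> * \<sigma> - \<theta> * \<eta>) \<le> k * (- \<eta>\<^sup>2 / 4)"
        by (rule mult_left_mono) simp
      then show ?thesis by (intro ennreal_leI) (simp only: exp_le_cancel_iff)
    qed
    also have "exp (k * (- \<eta>\<^sup>2 / 4)) = q ^ k"
      unfolding q_def by (rule exp_of_nat_mult)
    finally show ?thesis .
  qed
  have "(\<integral>\<^sup>+ \<omega>. (\<Sum>k. ennreal (Z k \<omega>)) \<partial>M) = (\<Sum>k. \<integral>\<^sup>+ \<omega>. ennreal (Z k \<omega>) \<partial>M)"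
    by (intro nn_integral_suminf) measurable
  also have "\<dots> \<le> (\<Sum>k. ennreal (q ^ k))"
    by (intro suminf_le bound) auto
  finally have le: "(\<integral>\<^sup>+ \<omega>. (\<Sum>k. ennreal (Z k \<omega>)) \<partial>M) \<le> (\<Sum>k. ennreal (q ^ k))" .
  have "(\<Sum>k. ennreal (q ^ k)) \<noteq> top"
    by (rule ennreal_suminf_neq_top[OF summable_geometric]) (use q in auto)
  with le have "(\<integral>\<^sup>+ \<omega>. (\<Sum>k. ennreal (Z k \<omega>)) \<partial>M) \<noteq> \<infinity>"
    by (metis infinity_ennreal_def top_unique)
  moreover have "(\<lambda>\<omega>. \<Sum>k. ennreal (Z k \<omega>)) \<in> borel_measurable M"
    by measurable
  ultimately have "AE \<omega> in M. (\<Sum>k. ennreal (Z k \<omega>)) \<noteq> \<infinity>"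
    by (intro nn_integral_PInf_AE)
  then show ?thesis
  proof eventually_elim
    case (elim \<omega>)
    then obtain S where S: "0 \<le> S" "(\<Sum>k. ennreal (Z k \<omega>)) = ennreal S"
      by (metis ennreal_cases infinity_ennreal_def)
    have Zle: "Z k \<omega> \<le> S" for k
    proof -
      have "ennreal (Z k \<omega>) \<le> (\<Sum>k. ennreal (Z k \<omega>))"
        using sum_le_suminf[OF summableI, of "{k}" "\<lambda>k. ennreal (Z k \<omega>)"] by simp
      then show ?thesis using S by (simp add: ennreal_le_iff)
    qed
    have "0 < Z 0 \<omega>" by (simp add: Z_def)
    then have "0 < S" using Zle[of 0] by linarith
    have "\<sigma> * (real (P (real k) \<omega>) - k) \<le> \<eta> * k + ln S / \<theta>" for k :: nat
    proof -
      have "\<theta> * (\<sigma> * (real (P (real k) \<omega>) - k) - \<eta> * k) \<le> ln S"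
        using Zle[of k] \<open>0 < S\<close> by (simp add: Z_def ln_ge_iff)
      then show ?thesis using \<theta> by (simp add: field_simps)
    qed
    then show ?case by blast
  qed
qed

text \<open>Monotonicity of the path carries the deviation bound from integer times to all times.\<close>

lemma (in prob_space) AE_asymptotically_linear:
  assumes P: "unit_poisson_process P"
  shows "AE \<omega> in M. asymptotically_linear (\<lambda>t. P t \<omega>)"
proof -
  have "AE \<omega> in M. \<forall>j. (\<exists>C. \<forall>k::nat. 1 * (real (P (real k) \<omega>) - k) \<le> (1 / Suc j) * k + C) \<and>
      (\<exists>C. \<forall>k::nat. (-1) * (real (P (real k) \<omega>) - k) \<le> (1 / Suc j) * k + C)"
    unfolding AE_all_countable
    by (intro allI AE_conjI AE_unit_poisson_deviation[OF P]) auto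
  with AE_space show ?thesis
  proof eventually_elim
    case (elim \<omega>)
    have mono: "mono_on {0..} (\<lambda>t. P t \<omega>)"
      using P elim(1) by (auto simp: unit_poisson_process_def)
    have "\<exists>C. \<forall>t\<ge>0. \<bar>real (P t \<omega>) - t\<bar> \<le> \<eta> * t + C" if "0 < \<eta>" for \<eta>
    proof -
      obtain j where j: "1 / real (Suc j) < \<eta>" using nat_approx_posE[OF \<open>0 < \<eta>\<close>] by blast
      define e where "e = 1 / real (Suc j)"
      obtain C1 C2 where
        C1: "\<And>k::nat. 1 * (real (P (real k) \<omega>) - k) \<le> e * k + C1" and
        C2: "\<And>k::nat. (-1) * (real (P (real k) \<omega>) - k) \<le> e * k + C2"
        using elim(2) unfolding e_def by meson
      have le: "e * k \<le> \<eta> * k" for k :: nat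
        using j by (intro mult_right_mono) (auto simp: e_def)
      have up: "real (P (real k) \<omega>) - k \<le> \<eta> * k + C1" for k :: nat
        using C1[of k] le[of k] by (simp add: algebra_simps)
      have low: "k - real (P (real k) \<omega>) \<le> \<eta> * k + C2" for k :: nat
        using C2[of k] le[of k] by (simp add: algebra_simps)
      have "\<bar>real (P t \<omega>) - t\<bar> \<le> \<eta> * t + (\<eta> + \<bar>C1\<bar> + \<bar>C2\<bar> + 1)" if "0 \<le> t" for t
      proof -
        define k k' where "k = nat \<lfloor>t\<rfloor>" and "k' = nat \<lceil>t\<rceil>"
        have "real k = of_int \<lfloor>t\<rfloor>" "real k' = of_int \<lceil>t\<rceil>"
          using that by (auto simp: k_def k'_def)
        then have k: "real k \<le> t" "t - 1 \<le> real k" "t \<le> real k'" "real k' \<le> t + 1"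
          by linarith+
        have "real (P (real k) \<omega>) \<le> P t \<omega>" "real (P t \<omega>) \<le> P (real k') \<omega>"
          using k that by (auto intro!: mono_onD[OF mono])
        moreover have "\<eta> * real k \<le> \<eta> * t" "\<eta> * real k' \<le> \<eta> * (t + 1)"
          using k \<open>0 < \<eta>\<close> by (auto intro!: mult_left_mono)
        moreover have "\<eta> * (t + 1) = \<eta> * t + \<eta>" by (simp add: distrib_left)
        ultimately show ?thesis using up[of k'] low[of k] k \<open>0 < \<eta>\<close> by linarith
      qed
      then show ?thesis by blast
    qed
    with mono show ?case by (simp add: asymptotically_linear_def)
  qed
qed

text \<open>The functional law of large numbers for a single path: \<open>u \<mapsto> p (n u)/n\<close> tends to the identity,
  uniformly on bounded intervals.\<close>

lemma asymptotically_linear_scaled: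
  assumes "asymptotically_linear p" and "0 < \<epsilon>"
  shows "\<forall>\<^sub>F n in sequentially. \<forall>c\<in>{0..B}. \<bar>real (p (real n * c)) / n - c\<bar> \<le> \<epsilon>"
proof -
  define \<eta> where "\<eta> = \<epsilon> / (2 * (\<bar>B\<bar> + 1))"
  have \<eta>: "0 < \<eta>" using assms by (auto simp: \<eta>_def)
  then obtain C where C: "\<And>t. t \<ge> 0 \<Longrightarrow> \<bar>real (p t) - t\<bar> \<le> \<eta> * t + C"
    using assms unfolding asymptotically_linear_def by blast
  have "\<forall>\<^sub>F n in sequentially. real n \<ge> 2 * \<bar>C\<bar> / \<epsilon> + 1"
    using filterlim_real_sequentially unfolding filterlim_at_top by blast
  then show ?thesis
  proof eventually_elim
    case (elim n)
    have "0 \<le> 2 * \<bar>C\<bar> / \<epsilon>" using assms by auto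
    then have n: "0 < real n" "2 * \<bar>C\<bar> / \<epsilon> \<le> real n" using elim by linarith+
    then have Cn: "C / n \<le> \<epsilon> / 2" using assms by (simp add: field_simps)
    show ?case
    proof
      fix c assume c: "c \<in> {0..B}"
      have "\<bar>real (p (real n * c)) / n - c\<bar> = \<bar>real (p (real n * c)) - real n * c\<bar> / n"
      proof -
        have "real (p (real n * c)) / n - c = (real (p (real n * c)) - real n * c) / n"
          using n by (simp add: field_simps)
        then show ?thesis using n by (simp add: abs_divide)
      qed
      also have "\<dots> \<le> (\<eta> * (real n * c) + C) / n"
        using C[of "real n * c"] c n by (intro divide_right_mono) auto
      also have "\<dots> = \<eta> * c + C / n" using n by (simp add: field_simps)
      also have "\<eta> * c \<le> \<eta> * (\<bar>B\<bar> + 1)" using c \<eta> by (intro mult_left_mono) auto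
      also have "\<eta> * (\<bar>B\<bar> + 1) = \<epsilon> / 2" by (simp add: \<eta>_def field_simps)
      finally show "\<bar>real (p (real n * c)) / n - c\<bar> \<le> \<epsilon>" using Cn by linarith
    qed
  qed
qed

section \<open>Fluid limits of a single queue\<close>

text \<open>The scaled path \<open>q n\<close> of one queue with arrival process \<open>a\<close> and departure process \<open>b\<close>, each run
  at its cumulative intensity. The cumulative arrival intensity \<open>c n\<close> is left abstract apart from
  its growth rate, so that the accepted and the rejected stream of a class are both instances.\<close>

locale scaled_queues =
  fixes a b :: "real \<Rightarrow> nat"
    and q c :: "nat \<Rightarrow> real \<Rightarrow> real"
    and k :: "nat \<Rightarrow> real"
    and k0 L \<mu> :: real
  assumes a: "asymptotically_linear a" and b: "asymptotically_linear b"
    and k: "k \<longlonglongrightarrow> k0" and L: "0 \<le> L" and \<mu>: "0 < \<mu>"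
    and k_nonneg: "\<And>n. 0 \<le> k n"
    and q_nonneg: "\<And>n t. 0 \<le> q n t"
    and q_int: "\<And>n t. 1 \<le> n \<Longrightarrow> 0 \<le> t \<Longrightarrow> q n integrable_on {0..t}"
    and c_0: "\<And>n. 1 \<le> n \<Longrightarrow> c n 0 = 0"
    and c_mono: "\<And>n s t. 1 \<le> n \<Longrightarrow> 0 \<le> s \<Longrightarrow> s \<le> t \<Longrightarrow> c n s \<le> c n t"
    and c_lip: "\<And>n s t. 1 \<le> n \<Longrightarrow> 0 \<le> s \<Longrightarrow> s \<le> t \<Longrightarrow> c n t - c n s \<le> L * (t - s)"
    and balance: "\<And>n t. 1 \<le> n \<Longrightarrow> 0 \<le> t \<Longrightarrow>
      q n t + real (b (real n * (\<mu> * integral {0..t} (q n)))) / n = k n + real (a (real n * c n t)) / n"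
begin

lemma k0_nonneg: "0 \<le> k0"
  by (rule LIMSEQ_le_const[OF k]) (use k_nonneg in auto)

lemma c_bounds:
  assumes "1 \<le> n" "0 \<le> t" "t \<le> T"
  shows "0 \<le> c n t" "c n t \<le> L * T"
proof -
  show "0 \<le> c n t" using c_mono[of n 0 t] c_0[of n] assms by simp
  have "c n t \<le> L * t" using c_lip[of n 0 t] c_0[of n] assms by simp
  also have "\<dots> \<le> L * T" using assms L by (intro mult_left_mono) auto
  finally show "c n t \<le> L * T" .
qed

text \<open>A Lipschitz constant for every limit of the queue on \<open>[0, T]\<close>: arrivals enter at rate at most
  \<open>L\<close>, departures leave at rate \<open>\<mu>\<close> times the queue, and the queue is bounded by its initial value
  plus all arrivals. The slack \<open>2\<close> absorbs the random error for large \<open>n\<close>. It matters that these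
  constants do not depend on the sample path.\<close>

definition bound :: "real \<Rightarrow> real" where "bound T = k0 + L * T + 2"
definition lip :: "real \<Rightarrow> real" where "lip T = L + \<mu> * bound T"

lemma bound_nonneg: "0 \<le> T \<Longrightarrow> 0 \<le> bound T"
  using k0_nonneg L by (simp add: bound_def)

lemma lip_nonneg: "0 \<le> T \<Longrightarrow> 0 \<le> lip T"
  using bound_nonneg[of T] L \<mu> by (simp add: lip_def)

lemma eventually_bounded:
  assumes "0 \<le> T"
  shows "\<forall>\<^sub>F n in sequentially. \<forall>t\<in>{0..T}. q n t \<le> bound T"
proof -
  have "\<forall>\<^sub>F n in sequentially. k n < k0 + 1"
    using k by (rule order_tendstoD) simp
  moreover have "\<forall>\<^sub>F n in sequentially. \<forall>x\<in>{0..L * T}. \<bar>real (a (real n * x)) / n - x\<bar> \<le> 1"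
    by (rule asymptotically_linear_scaled[OF a]) simp
  ultimately show ?thesis using eventually_ge_at_top[of 1]
  proof eventually_elim
    case (elim n)
    show ?case
    proof
      fix t assume t: "t \<in> {0..T}"
      then have c: "c n t \<in> {0..L * T}" using c_bounds[of n t T] elim by auto
      have "q n t \<le> k n + real (a (real n * c n t)) / n"
        using balance[of n t] elim t
        by (smt (verit) atLeastAtMost_iff divide_nonneg_nonneg of_nat_0_le_iff)
      then show "q n t \<le> bound T" using c elim(1) bspec[OF elim(2) c]
        unfolding bound_def atLeastAtMost_iff by linarith
    qed
  qed
qed

lemma integral_increment:
  assumes "1 \<le> n" "0 \<le> s" "s \<le> t" "\<And>u. u \<in> {0..t} \<Longrightarrow> q n u \<le> B"
  shows "0 \<le> integral {0..t} (q n) - integral {0..s} (q n)"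
    and "integral {0..t} (q n) - integral {0..s} (q n) \<le> B * (t - s)"
proof -
  have i: "q n integrable_on {s..t}"
    using q_int[of n t] assms by (auto intro: integrable_on_subinterval)
  have "integral {0..s} (q n) + integral {s..t} (q n) = integral {0..t} (q n)"
    using assms q_int[of n t] by (intro Henstock_Kurzweil_Integration.integral_combine) auto
  moreover have "0 \<le> integral {s..t} (q n)"
    using i q_nonneg by (intro Henstock_Kurzweil_Integration.integral_nonneg) auto
  moreover have "integral {s..t} (q n) \<le> integral {s..t} (\<lambda>_. B)"
    using i assms by (intro integral_le) auto
  ultimately show "0 \<le> integral {0..t} (q n) - integral {0..s} (q n)"
    "integral {0..t} (q n) - integral {0..s} (q n) \<le> B * (t - s)"
    using assms by (auto simp: mult.commute)
qed

text \<open>The scaled paths need not be Lipschitz, since they jump, but they are so up to an error that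
  vanishes with \<open>n\<close>. This asymptotic equicontinuity passes
  convergence from a countable dense set of times to all times, and from one time to a
  neighbourhood of it.\<close>

lemma eventually_increment:
  assumes "0 \<le> T" "0 < \<epsilon>"
  shows "\<forall>\<^sub>F n in sequentially. \<forall>t\<in>{0..T}. \<forall>s\<in>{0..t}. \<bar>q n t - q n s\<bar> \<le> lip T * (t - s) + \<epsilon>"
proof -
  have "\<forall>\<^sub>F n in sequentially. \<forall>x\<in>{0..L * T}. \<bar>real (a (real n * x)) / n - x\<bar> \<le> \<epsilon> / 4"
    by (rule asymptotically_linear_scaled[OF a]) (use assms in simp)
  moreover have "\<forall>\<^sub>F n in sequentially. \<forall>x\<in>{0..\<mu> * (bound T * T)}. \<bar>real (b (real n * x)) / n - x\<bar> \<le> \<epsilon> / 4"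
    by (rule asymptotically_linear_scaled[OF b]) (use assms in simp)
  ultimately show ?thesis using eventually_ge_at_top[of 1] eventually_bounded[OF assms(1)]
  proof eventually_elim
    case (elim n)
    show ?case
    proof (intro ballI)
      fix t s assume t: "t \<in> {0..T}" and s: "s \<in> {0..t}"
      let ?I = "\<lambda>t. integral {0..t} (q n)"
      have I: "?I u \<in> {0..bound T * T}" if "u \<in> {0..T}" for u
      proof -
        have "?I u \<le> bound T * u" using integral_increment(2)[of n 0 u "bound T"] elim that by auto
        also have "\<dots> \<le> bound T * T" using that bound_nonneg[OF assms(1)] by (intro mult_left_mono) auto
        finally show ?thesis using integral_increment(1)[of n 0 u "bound T"] elim that by auto
      qed
      have dI: "0 \<le> \<mu> * ?I t - \<mu> * ?I s" "\<mu> * ?I t - \<mu> * ?I s \<le> \<mu> * bound T * (t - s)"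
        using integral_increment[of n s t "bound T"] elim t s \<mu>
        by (auto simp: mult.assoc simp flip: right_diff_distrib intro!: mult_nonneg_nonneg mult_left_mono)
      have A: "\<bar>real (a (real n * c n u)) / n - c n u\<bar> \<le> \<epsilon> / 4"
        and B: "\<bar>real (b (real n * (\<mu> * ?I u))) / n - \<mu> * ?I u\<bar> \<le> \<epsilon> / 4" if "u \<in> {0..T}" for u
        using bspec[OF elim(1), of "c n u"] bspec[OF elim(2), of "\<mu> * ?I u"] c_bounds[of n u T] elim(3) I[OF that] that \<mu>
        by auto
      have "0 \<le> c n t - c n s" "c n t - c n s \<le> L * (t - s)"
        using c_mono[of n s t] c_lip[of n s t] elim(3) s by auto
      then show "\<bar>q n t - q n s\<bar> \<le> lip T * (t - s) + \<epsilon>"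
        using A[of t] A[of s] B[of t] B[of s] balance[of n t] balance[of n s] elim(3) s t dI
          mult_nonneg_nonneg[OF L, of "t - s"]
        unfolding lip_def distrib_right atLeastAtMost_iff by linarith
    qed
  qed
qed

text \<open>Two times suffice, which makes the bound usable when convergence at different times holds on
  different almost sure events.\<close>

lemma limit_increment:
  assumes "0 \<le> s" "s \<le> t" "t \<le> T" and "(\<lambda>n. q n s) \<longlonglongrightarrow> x" "(\<lambda>n. q n t) \<longlonglongrightarrow> y"
  shows "\<bar>y - x\<bar> \<le> lip T * (t - s)"
proof (rule field_le_epsilon)
  fix \<epsilon> :: real assume "0 < \<epsilon>"
  have "\<forall>\<^sub>F n in sequentially. \<bar>q n t - q n s\<bar> \<le> lip T * (t - s) + \<epsilon>"
    using eventually_increment[of T, OF _ \<open>0 < \<epsilon>\<close>] assms by (auto elim!: eventually_mono)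
  moreover have "(\<lambda>n. \<bar>q n t - q n s\<bar>) \<longlonglongrightarrow> \<bar>y - x\<bar>"
    by (intro tendsto_intros assms)
  ultimately show "\<bar>y - x\<bar> \<le> lip T * (t - s) + \<epsilon>"
    by (intro tendsto_upperbound) auto
qed

lemma limit_from_rationals:
  assumes rat: "\<And>r. r \<in> \<rat> \<Longrightarrow> 0 \<le> r \<Longrightarrow> (\<lambda>n. q n r) \<longlonglongrightarrow> f r"
    and lip_f: "\<And>s t T. 0 \<le> s \<Longrightarrow> s \<le> t \<Longrightarrow> t \<le> T \<Longrightarrow> \<bar>f t - f s\<bar> \<le> lip T * (t - s)"
    and t: "0 \<le> t"
  shows "(\<lambda>n. q n t) \<longlonglongrightarrow> f t"
proof (rule LIMSEQ_I, unfold real_norm_def)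
  fix \<epsilon> :: real assume \<epsilon>: "0 < \<epsilon>"
  define \<delta> where "\<delta> = \<epsilon> / (4 * (lip (t + 1) + 1))"
  have lp: "0 \<le> lip (t + 1)" using lip_nonneg t by simp
  have \<delta>: "0 < \<delta>" using \<epsilon> lp by (simp add: \<delta>_def)
  obtain r where r: "r \<in> \<rat>" "t < r" "r < t + min 1 \<delta>"
    using Rats_dense_in_real[of t "t + min 1 \<delta>"] \<delta> by auto
  have "lip (t + 1) * (r - t) \<le> (lip (t + 1) + 1) * \<delta>" using r lp by (intro mult_mono) auto
  also have "\<dots> = \<epsilon> / 4" using lp by (simp add: \<delta>_def field_simps)
  finally have 1: "lip (t + 1) * (r - t) \<le> \<epsilon> / 4" .
  have 2: "\<bar>f r - f t\<bar> \<le> \<epsilon> / 4" using lip_f[of t r "t + 1"] r t 1 by linarith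
  have "\<forall>\<^sub>F n in sequentially. \<bar>q n r - f r\<bar> < \<epsilon> / 8"
    using LIMSEQ_D[OF rat, of r "\<epsilon> / 8"] r t \<epsilon> by (auto simp: eventually_sequentially)
  moreover have "\<forall>\<^sub>F n in sequentially. \<bar>q n r - q n t\<bar> \<le> lip (t + 1) * (r - t) + \<epsilon> / 8"
    using eventually_increment[of "t + 1" "\<epsilon> / 8"] \<epsilon> r t by (auto elim!: eventually_mono)
  ultimately have "\<forall>\<^sub>F n in sequentially. \<bar>q n t - f t\<bar> < \<epsilon>"
    by eventually_elim (use 1 2 \<epsilon> in linarith)
  then show "\<exists>no. \<forall>n\<ge>no. \<bar>q n t - f t\<bar> < \<epsilon>" by (simp add: eventually_sequentially)
qed

lemma limit_continuous:
  assumes lip_f: "\<And>s t T. 0 \<le> s \<Longrightarrow> s \<le> t \<Longrightarrow> t \<le> T \<Longrightarrow> \<bar>f t - f s\<bar> \<le> lip T * (t - s)"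
  shows "continuous_on {0..} f"
  unfolding continuous_on_iff
proof (intro ballI allI impI)
  fix t \<epsilon> :: real assume t: "t \<in> {0..}" and \<epsilon>: "0 < \<epsilon>"
  define \<delta> where "\<delta> = min 1 (\<epsilon> / (lip (t + 1) + 1))"
  have lp: "0 \<le> lip (t + 1)" using lip_nonneg t by simp
  have \<delta>: "0 < \<delta>" using \<epsilon> lp by (simp add: \<delta>_def)
  have "dist (f s) (f t) < \<epsilon>" if s: "s \<in> {0..}" "dist s t < \<delta>" for s
  proof -
    have "\<bar>f s - f t\<bar> \<le> lip (t + 1) * \<bar>s - t\<bar>"
    proof (cases "s \<le> t")
      case True
      then show ?thesis
        using lip_f[of s t "t + 1"] s by (simp add: abs_minus_commute[of "f s"] abs_minus_commute[of s])
    next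
      case False
      then have "s \<le> t + 1" "\<bar>s - t\<bar> = s - t" using s by (auto simp: dist_real_def \<delta>_def)
      then show ?thesis using lip_f[of t s "t + 1"] t False by simp
    qed
    also have "\<dots> \<le> (lip (t + 1) + 1) * \<bar>s - t\<bar>" by (intro mult_right_mono) auto
    also have "\<dots> < (lip (t + 1) + 1) * (\<epsilon> / (lip (t + 1) + 1))"
      using s lp by (intro mult_strict_left_mono) (auto simp: dist_real_def \<delta>_def)
    also have "\<dots> = \<epsilon>" using lp by simp
    finally show ?thesis by (simp add: dist_real_def)
  qed
  with \<delta> show "\<exists>\<delta>>0. \<forall>s\<in>{0..}. dist s t < \<delta> \<longrightarrow> dist (f s) (f t) < \<epsilon>" by blast
qed

lemma eventually_close_to_limit:
  assumes lim: "(\<lambda>n. q n t) \<longlonglongrightarrow> y" and "0 \<le> t" "0 < \<epsilon>"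
  shows "\<exists>\<delta>>0. \<forall>\<^sub>F n in sequentially. \<forall>r\<in>{t..t + \<delta>}. \<bar>q n r - y\<bar> < \<epsilon>"
proof -
  define \<delta> where "\<delta> = min 1 (\<epsilon> / (4 * (lip (t + 1) + 1)))"
  have lp: "0 \<le> lip (t + 1)" using lip_nonneg assms by simp
  have \<delta>: "0 < \<delta>" "\<delta> \<le> 1" using assms lp by (auto simp: \<delta>_def)
  have "lip (t + 1) * \<delta> \<le> (lip (t + 1) + 1) * (\<epsilon> / (4 * (lip (t + 1) + 1)))"
    using lp \<delta> by (intro mult_mono) (auto simp: \<delta>_def)
  also have "\<dots> = \<epsilon> / 4" using lp by (simp add: field_simps)
  finally have 1: "lip (t + 1) * \<delta> \<le> \<epsilon> / 4" .
  have "\<forall>\<^sub>F n in sequentially. \<bar>q n t - y\<bar> < \<epsilon> / 4"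
    using LIMSEQ_D[OF lim, of "\<epsilon> / 4"] assms by (auto simp: eventually_sequentially)
  moreover have "\<forall>\<^sub>F n in sequentially. \<forall>r\<in>{0..t+1}. \<forall>s\<in>{0..r}. \<bar>q n r - q n s\<bar> \<le> lip (t + 1) * (r - s) + \<epsilon> / 4"
    using eventually_increment[of "t + 1" "\<epsilon> / 4"] assms by auto
  ultimately have "\<forall>\<^sub>F n in sequentially. \<forall>r\<in>{t..t + \<delta>}. \<bar>q n r - y\<bar> < \<epsilon>"
  proof eventually_elim
    case (elim n)
    show ?case
    proof
      fix r assume r: "r \<in> {t..t + \<delta>}"
      have "lip (t + 1) * (r - t) \<le> lip (t + 1) * \<delta>" using r lp by (intro mult_left_mono) auto
      moreover have "\<bar>q n r - q n t\<bar> \<le> lip (t + 1) * (r - t) + \<epsilon> / 4"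
        using elim(2) r \<delta> assms by auto
      ultimately show "\<bar>q n r - y\<bar> < \<epsilon>" using elim(1) 1 \<open>0 < \<epsilon>\<close> by linarith
    qed
  qed
  with \<delta> show ?thesis by blast
qed

lemma integral_limit:
  assumes lim: "\<And>u. 0 \<le> u \<Longrightarrow> (\<lambda>n. q n u) \<longlonglongrightarrow> f u" and t: "0 \<le> t"
  shows "(\<lambda>n. integral {0..t} (q n)) \<longlonglongrightarrow> integral {0..t} f"
proof -
  obtain n0 where n0: "\<And>n u. n \<ge> n0 \<Longrightarrow> u \<in> {0..t} \<Longrightarrow> q n u \<le> bound t"
    using eventually_bounded[OF t] unfolding eventually_sequentially by blast
  \<comment> \<open>the paths are bounded from \<open>n0\<close> on and integrable from \<open>1\<close> on\<close>
  let ?m = "Suc n0"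
  have "(\<lambda>n. integral {0..t} (q (n + ?m))) \<longlonglongrightarrow> integral {0..t} f"
  proof (rule dominated_convergence)
    show "(\<lambda>_. bound t) integrable_on {0..t}" by (rule integrable_const_ivl)
    show "q (n + ?m) integrable_on {0..t}" for n using q_int t by simp
    show "norm (q (n + ?m) u) \<le> bound t" if "u \<in> {0..t}" for n u
      using n0[of "n + ?m" u] that q_nonneg[of "n + ?m" u] by simp
    show "(\<lambda>n. q (n + ?m) u) \<longlonglongrightarrow> f u" if "u \<in> {0..t}" for u
      using lim[of u] that by (intro LIMSEQ_ignore_initial_segment) auto
  qed
  then show ?thesis by (rule LIMSEQ_offset)
qed

text \<open>In the balance equation every term other than the arrivals converges, so the cumulative arrival
  intensity converges as well, along the whole sequence.\<close>

lemma arrivals_limit: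
  assumes lim: "\<And>u. 0 \<le> u \<Longrightarrow> (\<lambda>n. q n u) \<longlonglongrightarrow> f u" and t: "0 \<le> t"
  shows "(\<lambda>n. c n t) \<longlonglongrightarrow> f t + \<mu> * integral {0..t} f - k0"
proof -
  let ?I = "\<lambda>n. \<mu> * integral {0..t} (q n)"
  have I: "?I \<longlonglongrightarrow> \<mu> * integral {0..t} f"
    by (intro tendsto_intros integral_limit lim t)
  have I_nonneg: "0 \<le> ?I n" if "1 \<le> n" for n
    using q_int[OF that t] q_nonneg \<mu>
    by (auto intro!: mult_nonneg_nonneg Henstock_Kurzweil_Integration.integral_nonneg)
  have small: "(\<lambda>n. real (p (real n * x n)) / n - x n) \<longlonglongrightarrow> 0"
    if p: "asymptotically_linear p" and x: "\<forall>\<^sub>F n in sequentially. x n \<in> {0..B}" for p x B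
  proof (rule tendstoI)
    fix \<epsilon> :: real assume \<epsilon>: "0 < \<epsilon>"
    have "\<forall>\<^sub>F n in sequentially. \<forall>y\<in>{0..B}. \<bar>real (p (real n * y)) / n - y\<bar> \<le> \<epsilon> / 2"
      by (rule asymptotically_linear_scaled[OF p]) (use \<epsilon> in simp)
    with x show "\<forall>\<^sub>F n in sequentially. dist (real (p (real n * x n)) / n - x n) 0 < \<epsilon>"
    proof eventually_elim
      case (elim n)
      show ?case using bspec[OF elim(2,1)] \<epsilon> by simp
    qed
  qed
  have "\<forall>\<^sub>F n in sequentially. c n t \<in> {0..L * t}"
    using eventually_ge_at_top[of 1] by eventually_elim (use c_bounds[of _ t t] t in auto)
  then have A: "(\<lambda>n. real (a (real n * c n t)) / n - c n t) \<longlonglongrightarrow> 0" by (rule small[OF a])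
  have "\<forall>\<^sub>F n in sequentially. ?I n < \<mu> * integral {0..t} f + 1"
    using I by (rule order_tendstoD) simp
  then have "\<forall>\<^sub>F n in sequentially. ?I n \<in> {0..\<mu> * integral {0..t} f + 1}"
    using eventually_ge_at_top[of 1] by eventually_elim (use I_nonneg in auto)
  then have B: "(\<lambda>n. real (b (real n * ?I n)) / n - ?I n) \<longlonglongrightarrow> 0" by (rule small[OF b])
  have "(\<lambda>n. q n t + (real (b (real n * ?I n)) / n - ?I n) + ?I n - k n
      - (real (a (real n * c n t)) / n - c n t)) \<longlonglongrightarrow> f t + 0 + \<mu> * integral {0..t} f - k0 - 0"
    by (intro tendsto_intros lim t A B I k)
  then have "(\<lambda>n. q n t + (real (b (real n * ?I n)) / n - ?I n) + ?I n - k n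
      - (real (a (real n * c n t)) / n - c n t)) \<longlonglongrightarrow> f t + \<mu> * integral {0..t} f - k0"
    by simp
  then show ?thesis
  proof (rule Lim_transform_eventually)
    show "\<forall>\<^sub>F n in sequentially. q n t + (real (b (real n * ?I n)) / n - ?I n) + ?I n - k n
      - (real (a (real n * c n t)) / n - c n t) = c n t"
      using eventually_ge_at_top[of 1]
    proof eventually_elim
      case (elim n)
      show ?case using balance[of n t] elim t by linarith
    qed
  qed
qed

end

section \<open>The gradient of the penalty function\<close>

definition load_x :: "real ^ 'm ^ 's \<Rightarrow> real ^ 's \<Rightarrow> real ^ 'm \<Rightarrow> 's \<Rightarrow> 'm::finite \<Rightarrow> real"
  where "load_x D h \<rho> j i = pos_mat D $ j $ i / (h $ j + (neg_mat D *v \<rho>) $ j)"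

definition load_y :: "real ^ 'm ^ 's \<Rightarrow> real ^ 's \<Rightarrow> real ^ 'm \<Rightarrow> 's \<Rightarrow> 'm::finite \<Rightarrow> real"
  where "load_y D h \<rho> j i = neg_mat D $ j $ i / (h $ j + (neg_mat D *v \<rho>) $ j)"

definition grad_x ::
  "real \<Rightarrow> real ^ 'm ^ 's::finite \<Rightarrow> real ^ 's \<Rightarrow> real ^ 'm \<Rightarrow> 'm::finite \<Rightarrow> real ^ 'm \<Rightarrow> real ^ 'm \<Rightarrow> real"
  where "grad_x \<beta> D h \<rho> i x y =
    (\<Sum>j\<in>UNIV. exp (\<beta> * norm_load D h \<rho> j x y) * (\<beta> * load_x D h \<rho> j i))"

definition grad_y ::
  "real \<Rightarrow> real ^ 'm ^ 's::finite \<Rightarrow> real ^ 's \<Rightarrow> real ^ 'm \<Rightarrow> 'm::finite \<Rightarrow> real ^ 'm \<Rightarrow> real ^ 'm \<Rightarrow> real"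
  where "grad_y \<beta> D h \<rho> i x y =
    (\<Sum>j\<in>UNIV. exp (\<beta> * norm_load D h \<rho> j x y) * (\<beta> * load_y D h \<rho> j i))"

lemma norm_load_eq_sum:
  "norm_load D h \<rho> j x y = (\<Sum>i\<in>UNIV. load_x D h \<rho> j i * x $ i + load_y D h \<rho> j i * y $ i)"
  by (simp add: norm_load_def load_x_def load_y_def matrix_vector_mult_def sum.distrib
      sum_divide_distrib add_divide_distrib)

lemma norm_load_scaleR:
  "norm_load D h \<rho> j (r *\<^sub>R x) (r *\<^sub>R y) = r * norm_load D h \<rho> j x y"
  by (simp add: norm_load_eq_sum sum_distrib_left algebra_simps)

lemma norm_load_axis:
  fixes x y :: "real ^ 'm::finite"
  shows "norm_load D h \<rho> j (x + u *\<^sub>R axis i 1) y = norm_load D h \<rho> j x y + load_x D h \<rho> j i * u"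
    and "norm_load D h \<rho> j x (y + u *\<^sub>R axis i 1) = norm_load D h \<rho> j x y + load_y D h \<rho> j i * u"
proof -
  have "(\<Sum>l\<in>UNIV. w l * (u *\<^sub>R axis i 1 :: real ^ 'm) $ l) = w i * u" for w :: "'m \<Rightarrow> real"
    by (simp add: axis_def if_distrib[of "\<lambda>z. _ * (_ * z)"] cong: if_cong)
  then show
    "norm_load D h \<rho> j (x + u *\<^sub>R axis i 1) y = norm_load D h \<rho> j x y + load_x D h \<rho> j i * u"
    "norm_load D h \<rho> j x (y + u *\<^sub>R axis i 1) = norm_load D h \<rho> j x y + load_y D h \<rho> j i * u"
    by (simp_all add: norm_load_eq_sum distrib_left sum.distrib del: vector_scaleR_component)
qed

lemma partial_penalty:
  "partial_x (penalty \<beta> D h \<rho>) i x y = grad_x \<beta> D h \<rho> i x y"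
  "partial_y (penalty \<beta> D h \<rho>) i x y = grad_y \<beta> D h \<rho> i x y"
  unfolding partial_x_def partial_y_def penalty_def norm_load_axis grad_x_def grad_y_def
  by (rule DERIV_imp_deriv, auto intro!: derivative_eq_intros sum.cong)+

lemma accepts_iff:
  "accepts \<beta> D h \<rho> i x y \<longleftrightarrow> grad_x \<beta> D h \<rho> i x y \<le> grad_y \<beta> D h \<rho> i x y"
  by (simp add: accepts_def partial_penalty)

text \<open>Convexity of the penalty as a function of the joint state: \<open>exp b - exp a \<ge> exp a (b - a)\<close> for each
  constraint, whose load is linear in the state.\<close>

lemma penalty_above_tangent:
  "(\<Sum>i\<in>UNIV. grad_x \<beta> D h \<rho> i x y * (x' $ i - x $ i) + grad_y \<beta> D h \<rho> i x y * (y' $ i - y $ i))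
    \<le> penalty \<beta> D h \<rho> x' y' - penalty \<beta> D h \<rho> x y"
proof -
  let ?l = "\<lambda>j x y. \<beta> * norm_load D h \<rho> j x y"
  have "(\<Sum>i\<in>UNIV. grad_x \<beta> D h \<rho> i x y * (x' $ i - x $ i) + grad_y \<beta> D h \<rho> i x y * (y' $ i - y $ i))
    = (\<Sum>i\<in>UNIV. \<Sum>j\<in>UNIV. exp (?l j x y) * (\<beta> * (load_x D h \<rho> j i * (x' $ i - x $ i) + load_y D h \<rho> j i * (y' $ i - y $ i))))"
    unfolding grad_x_def grad_y_def sum_distrib_right sum.distrib[symmetric]
    by (intro sum.cong) (simp_all add: algebra_simps)
  also have "\<dots> = (\<Sum>j\<in>UNIV. exp (?l j x y) * (?l j x' y' - ?l j x y))"
  proof -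
    have "?l j x' y' - ?l j x y
        = (\<Sum>i\<in>UNIV. \<beta> * (load_x D h \<rho> j i * (x' $ i - x $ i) + load_y D h \<rho> j i * (y' $ i - y $ i)))" for j
      unfolding norm_load_eq_sum sum_distrib_left sum_subtractf[symmetric]
      by (intro sum.cong) (simp_all add: algebra_simps)
    then show ?thesis by (subst sum.swap) (simp add: sum_distrib_left)
  qed
  also have "\<dots> \<le> (\<Sum>j\<in>UNIV. exp (?l j x' y') - exp (?l j x y))"
  proof (rule sum_mono)
    fix j
    have "exp (?l j x y) * (1 + (?l j x' y' - ?l j x y)) \<le> exp (?l j x y) * exp (?l j x' y' - ?l j x y)"
      by (intro mult_left_mono exp_ge_add_one_self) simp
    then show "exp (?l j x y) * (?l j x' y' - ?l j x y) \<le> exp (?l j x' y') - exp (?l j x y)"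
      by (simp add: exp_diff distrib_left)
  qed
  finally show ?thesis by (simp add: penalty_def sum_subtractf)
qed

lemma tendsto_penalty_gradient:
  assumes "(f \<longlongrightarrow> x) F" "(g \<longlongrightarrow> y) F"
  shows "((\<lambda>t. grad_x \<beta> D h \<rho> i (f t) (g t)) \<longlongrightarrow> grad_x \<beta> D h \<rho> i x y) F"
    and "((\<lambda>t. grad_y \<beta> D h \<rho> i (f t) (g t)) \<longlongrightarrow> grad_y \<beta> D h \<rho> i x y) F"
    and "((\<lambda>t. penalty \<beta> D h \<rho> (f t) (g t)) \<longlongrightarrow> penalty \<beta> D h \<rho> x y) F"
  unfolding grad_x_def grad_y_def penalty_def norm_load_eq_sum
  by (intro tendsto_intros assms)+

text \<open>Where one partial derivative is strictly smaller, the routing decision for the class is constant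
  on a neighbourhood of the state.\<close>

lemma grad_less_nearby:
  fixes x y :: "real ^ 'm::finite"
  shows "grad_x \<beta> D h \<rho> i x y < grad_y \<beta> D h \<rho> i x y \<Longrightarrow>
      \<exists>e>0. \<forall>x' y'. (\<forall>l. \<bar>x' $ l - x $ l\<bar> < e \<and> \<bar>y' $ l - y $ l\<bar> < e) \<longrightarrow>
        grad_x \<beta> D h \<rho> i x' y' < grad_y \<beta> D h \<rho> i x' y'"
    and "grad_y \<beta> D h \<rho> i x y < grad_x \<beta> D h \<rho> i x y \<Longrightarrow>
      \<exists>e>0. \<forall>x' y'. (\<forall>l. \<bar>x' $ l - x $ l\<bar> < e \<and> \<bar>y' $ l - y $ l\<bar> < e) \<longrightarrow>
        grad_y \<beta> D h \<rho> i x' y' < grad_x \<beta> D h \<rho> i x' y'"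
proof -
  have cont: "continuous_on UNIV (\<lambda>p. grad_x \<beta> D h \<rho> i (fst p) (snd p))"
    "continuous_on UNIV (\<lambda>p. grad_y \<beta> D h \<rho> i (fst p) (snd p))"
    unfolding continuous_on_def
    by (intro ballI tendsto_penalty_gradient tendsto_fst[OF tendsto_ident_at] tendsto_snd[OF tendsto_ident_at])+
  have near: "\<exists>e>0. \<forall>x' y'. (\<forall>l. \<bar>x' $ l - x $ l\<bar> < e \<and> \<bar>y' $ l - y $ l\<bar> < e) \<longrightarrow> (x', y') \<in> S"
    if S: "open S" "(x, y) \<in> S" for S :: "((real ^ 'm) \<times> (real ^ 'm)) set"
  proof -
    obtain d where d: "0 < d" "ball (x, y) d \<subseteq> S" by (rule openE[OF S])
    define e where "e = d / (2 * real CARD('m))"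
    have e: "0 < e" using d by (simp add: e_def)
    have "(x', y') \<in> S" if c: "\<And>l. \<bar>x' $ l - x $ l\<bar> < e" "\<And>l. \<bar>y' $ l - y $ l\<bar> < e" for x' y'
    proof -
      have small: "dist u v < d / 2" if "\<And>l. \<bar>u $ l - v $ l\<bar> < e" for u v :: "real ^ 'm"
      proof -
        have "dist u v \<le> (\<Sum>l\<in>UNIV. \<bar>(u - v) $ l\<bar>)" unfolding dist_norm by (rule norm_le_l1_cart)
        also have "\<dots> < (\<Sum>l\<in>(UNIV :: 'm set). e)" by (intro sum_strict_mono) (use that in auto)
        also have "\<dots> = d / 2" by (simp add: e_def)
        finally show ?thesis .
      qed
      have "dist (x', y') (x, y) \<le> dist x' x + dist y' y"
        unfolding dist_Pair_Pair by (rule sqrt_sum_squares_le_sum) auto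
      also have "\<dots> < d" using small[of x' x] small[of y' y] c by auto
      finally show ?thesis using d by (auto simp: dist_commute)
    qed
    with e show ?thesis by blast
  qed
  show "\<exists>e>0. \<forall>x' y'. (\<forall>l. \<bar>x' $ l - x $ l\<bar> < e \<and> \<bar>y' $ l - y $ l\<bar> < e) \<longrightarrow>
        grad_x \<beta> D h \<rho> i x' y' < grad_y \<beta> D h \<rho> i x' y'"
    if "grad_x \<beta> D h \<rho> i x y < grad_y \<beta> D h \<rho> i x y"
    using near[OF open_Collect_less[OF cont(1,2)]] that by simp
  show "\<exists>e>0. \<forall>x' y'. (\<forall>l. \<bar>x' $ l - x $ l\<bar> < e \<and> \<bar>y' $ l - y $ l\<bar> < e) \<longrightarrow>
        grad_y \<beta> D h \<rho> i x' y' < grad_x \<beta> D h \<rho> i x' y'"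
    if "grad_y \<beta> D h \<rho> i x y < grad_x \<beta> D h \<rho> i x y"
    using near[OF open_Collect_less[OF cont(2,1)]] that by simp
qed

section \<open>Fluid trajectories of the penalty policy\<close>

text \<open>The average of a continuous function over \<open>[t, r]\<close> tends to its value at \<open>t\<close>, written with the
  integrals from \<open>0\<close> that occur in the balance equations.\<close>

lemma average_tendsto_right:
  fixes f :: "real \<Rightarrow> real"
  assumes f: "continuous_on {0..} f" and t: "0 \<le> t"
  shows "((\<lambda>r. (integral {0..r} f - integral {0..t} f) / (r - t)) \<longlongrightarrow> f t) (at_right t)"
proof -
  have "((\<lambda>r. integral {0..r} f) has_real_derivative f t) (at t within {0..t + 1})"
    using t by (intro integral_has_real_derivative continuous_on_subset[OF f]) auto
  then have "((\<lambda>r. integral {0..r} f) has_real_derivative f t) (at t within {t..t + 1})"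
    by (rule has_field_derivative_subset) (use t in auto)
  then show ?thesis by (simp add: has_field_derivative_iff at_within_Icc_at_right)
qed

text \<open>A barrier argument for functions without derivatives: pick a level \<open>K'\<close> strictly between \<open>K\<close> and
  a value attained later, and consider the last time at which the function is at most \<open>K'\<close>. Just
  after that time the function is still at most \<open>K'\<close>, by continuity if the value there is at most
  \<open>K\<close>, and because it decreases otherwise.\<close>

lemma right_decreasing_above_level:
  fixes V :: "real \<Rightarrow> real"
  assumes V: "continuous_on {0..} V" and init: "V 0 \<le> K"
    and decr: "\<And>t. 0 \<le> t \<Longrightarrow> K < V t \<Longrightarrow> \<forall>\<^sub>F r in at_right t. V r < V t"
    and t: "0 \<le> t"
  shows "V t \<le> K"
proof (rule ccontr)
  assume "\<not> V t \<le> K"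
  then obtain K' where K': "K < K'" "K' < V t" using dense[of K "V t"] by auto
  let ?S = "{u \<in> {0..t}. V u \<in> {..K'}}"
  have "closed ?S"
    using continuous_on_subset[OF V, of "{0..t}"] by (intro continuous_closed_preimage[unfolded vimage_def Int_def, simplified]) auto
  then have "compact ?S"
    unfolding compact_eq_bounded_closed by (auto intro: bounded_subset[of "{0..t}"])
  moreover have "0 \<in> ?S" using t init K' by auto
  ultimately obtain t0 where t0: "t0 \<in> ?S" "\<And>u. u \<in> ?S \<Longrightarrow> u \<le> t0"
    using compact_attains_sup[of ?S] by blast
  have "t0 \<noteq> t" using t0(1) K' by auto
  then have "t0 < t" using t0(1) by simp
  have "\<forall>\<^sub>F r in at_right t0. V r \<le> K'"
  proof (cases "K < V t0")
    case True
    then have "\<forall>\<^sub>F r in at_right t0. V r < V t0" using decr[of t0] t0 by auto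
    then show ?thesis by eventually_elim (use t0 in auto)
  next
    case False
    have "(V \<longlongrightarrow> V t0) (at t0 within {0..})" using V t0 by (auto simp: continuous_on_def)
    then have "(V \<longlongrightarrow> V t0) (at_right t0)" by (rule tendsto_within_subset) (use t0 in auto)
    then have "\<forall>\<^sub>F r in at_right t0. V r < K'" by (rule order_tendstoD) (use False K' in auto)
    then show ?thesis by eventually_elim auto
  qed
  moreover have "\<forall>\<^sub>F r in at_right t0. t0 < r \<and> r < t"
    using eventually_at_right_less eventually_at_right_real[OF \<open>t0 < t\<close>] by eventually_elim auto
  ultimately have "\<forall>\<^sub>F r in at_right t0. False"
  proof eventually_elim
    case (elim r)
    then show ?case using t0(1) t0(2)[of r] by auto
  qed
  then show False by simp
qed

text \<open>The deterministic limit of the models. Here \<open>\<alpha> t $ i\<close> is the amount of time up to \<open>t\<close> during which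
  class \<open>i\<close> is accepted. The routing rule determines its growth only where the two partial
  derivatives differ; on the switching surface any growth rate between \<open>0\<close> and \<open>1\<close> is possible, so
  the state solves a differential inclusion rather than an equation.\<close>

locale fluid_trajectory =
  fixes \<beta> :: real and D :: "real ^ 'm::finite ^ 's::finite" and h :: "real ^ 's"
    and \<rho> lam \<mu> y0 :: "real ^ 'm" and x y \<alpha> :: "real \<Rightarrow> real ^ 'm"
  assumes lam: "\<And>i. 0 < lam $ i" and \<mu>: "\<And>i. 0 < \<mu> $ i" and \<rho>: "\<And>i. \<rho> $ i = lam $ i / \<mu> $ i"
    and nonneg: "\<And>t i. 0 \<le> t \<Longrightarrow> 0 \<le> x t $ i" "\<And>t i. 0 \<le> t \<Longrightarrow> 0 \<le> y t $ i"
    and cont: "\<And>i. continuous_on {0..} (\<lambda>t. x t $ i)" "\<And>i. continuous_on {0..} (\<lambda>t. y t $ i)"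
    and x_eq: "\<And>t i. 0 \<le> t \<Longrightarrow> x t $ i = lam $ i * \<alpha> t $ i - \<mu> $ i * integral {0..t} (\<lambda>u. x u $ i)"
    and y_eq: "\<And>t i. 0 \<le> t \<Longrightarrow>
      y t $ i = y0 $ i + lam $ i * (t - \<alpha> t $ i) - \<mu> $ i * integral {0..t} (\<lambda>u. y u $ i)"
    and \<alpha>_0: "\<And>i. \<alpha> 0 $ i = 0"
    and \<alpha>_incr: "\<And>s t i. 0 \<le> s \<Longrightarrow> s \<le> t \<Longrightarrow> 0 \<le> \<alpha> t $ i - \<alpha> s $ i \<and> \<alpha> t $ i - \<alpha> s $ i \<le> t - s"
    and accepting: "\<And>t i. 0 \<le> t \<Longrightarrow> grad_x \<beta> D h \<rho> i (x t) (y t) < grad_y \<beta> D h \<rho> i (x t) (y t) \<Longrightarrow>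
      \<forall>\<^sub>F r in at_right t. \<alpha> r $ i - \<alpha> t $ i = r - t"
    and rejecting: "\<And>t i. 0 \<le> t \<Longrightarrow> grad_y \<beta> D h \<rho> i (x t) (y t) < grad_x \<beta> D h \<rho> i (x t) (y t) \<Longrightarrow>
      \<forall>\<^sub>F r in at_right t. \<alpha> r $ i - \<alpha> t $ i = 0"
begin

text \<open>Above \<open>\<rho> $ i\<close> departures outweigh even the unthinned arrival stream.\<close>

lemma x_le_\<rho>:
  assumes "0 \<le> t"
  shows "x t $ i \<le> \<rho> $ i"
proof (rule right_decreasing_above_level[OF cont(1) _ _ assms])
  show "x 0 $ i \<le> \<rho> $ i" using x_eq[of 0 i] \<alpha>_0 \<rho> lam[of i] \<mu>[of i] by simp
  fix t assume t: "0 \<le> t" and gt: "\<rho> $ i < x t $ i"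
  let ?avg = "\<lambda>r. (integral {0..r} (\<lambda>u. x u $ i) - integral {0..t} (\<lambda>u. x u $ i)) / (r - t)"
  have "((\<lambda>r. lam $ i - \<mu> $ i * ?avg r) \<longlongrightarrow> lam $ i - \<mu> $ i * x t $ i) (at_right t)"
    by (intro tendsto_intros average_tendsto_right cont t)
  moreover have "lam $ i - \<mu> $ i * x t $ i < 0"
    using gt \<rho>[of i] \<mu>[of i] by (simp add: field_simps)
  ultimately have "\<forall>\<^sub>F r in at_right t. lam $ i - \<mu> $ i * ?avg r < 0" by (rule order_tendstoD)
  then show "\<forall>\<^sub>F r in at_right t. x r $ i < x t $ i"
    using eventually_at_right_less
  proof eventually_elim
    case (elim r)
    have avg: "(r - t) * ?avg r = integral {0..r} (\<lambda>u. x u $ i) - integral {0..t} (\<lambda>u. x u $ i)"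
      using elim by simp
    have "x r $ i - x t $ i = lam $ i * (\<alpha> r $ i - \<alpha> t $ i) - \<mu> $ i * ((r - t) * ?avg r)"
      unfolding avg using x_eq[of r i] x_eq[of t i] t elim by (simp add: algebra_simps)
    also have "\<dots> \<le> lam $ i * (r - t) - \<mu> $ i * ((r - t) * ?avg r)"
      using \<alpha>_incr[of t r i] lam[of i] t elim by (intro diff_right_mono mult_left_mono) auto
    also have "\<dots> = (r - t) * (lam $ i - \<mu> $ i * ?avg r)" by (simp only: algebra_simps)
    also have "\<dots> < 0" using elim by (intro mult_pos_neg) auto
    finally show ?case by simp
  qed
qed

text \<open>Acceptance only splits the arrival stream, so the total of both systems solves
  \<open>z' = \<lambda> - \<mu> z\<close> with \<open>z 0 = y0\<close>, independently of the policy.\<close>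

lemma total_eq:
  assumes t: "0 \<le> t"
  shows "x t $ i + y t $ i = \<rho> $ i - exp (- \<mu> $ i * t) * (\<rho> $ i - y0 $ i)"
proof -
  define z where "z u = x u $ i + y u $ i" for u
  have z_cont: "continuous_on {0..t} z"
    unfolding z_def by (intro continuous_intros continuous_on_subset[OF cont(1)] continuous_on_subset[OF cont(2)]) auto
  have z_eq: "z u = y0 $ i + lam $ i * u - \<mu> $ i * integral {0..u} z" if "0 \<le> u" for u
  proof -
    have "integral {0..u} z = integral {0..u} (\<lambda>u. x u $ i) + integral {0..u} (\<lambda>u. y u $ i)"
      unfolding z_def
      by (intro Henstock_Kurzweil_Integration.integral_add integrable_continuous_interval
          continuous_on_subset[OF cont(1)] continuous_on_subset[OF cont(2)]) auto
    then show ?thesis using x_eq[OF that, of i] y_eq[OF that, of i] by (simp add: z_def algebra_simps)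
  qed
  have "((\<lambda>u. exp (\<mu> $ i * u) * (z u - \<rho> $ i)) has_real_derivative 0) (at u within {0..t})"
    if u: "u \<in> {0..t}" for u
  proof -
    have "((\<lambda>v. y0 $ i + lam $ i * v - \<mu> $ i * integral {0..v} z) has_real_derivative lam $ i - \<mu> $ i * z u)
        (at u within {0..t})"
      by (auto intro!: derivative_eq_intros integral_has_real_derivative z_cont u)
    then have "(z has_real_derivative lam $ i - \<mu> $ i * z u) (at u within {0..t})"
      by (rule has_field_derivative_transform_within[OF _ zero_less_one u]) (use z_eq in auto)
    then have "((\<lambda>u. exp (\<mu> $ i * u) * (z u - \<rho> $ i)) has_real_derivative
        exp (\<mu> $ i * u) * \<mu> $ i * (z u - \<rho> $ i) + exp (\<mu> $ i * u) * (lam $ i - \<mu> $ i * z u)) (at u within {0..t})"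
      by (auto intro!: derivative_eq_intros simp: algebra_simps)
    moreover have "lam $ i = \<mu> $ i * \<rho> $ i" using \<rho>[of i] \<mu>[of i] by simp
    then have "exp (\<mu> $ i * u) * \<mu> $ i * (z u - \<rho> $ i) + exp (\<mu> $ i * u) * (lam $ i - \<mu> $ i * z u) = 0"
      by (simp add: algebra_simps)
    ultimately show ?thesis by (simp only:)
  qed
  then obtain c where c: "\<And>u. u \<in> {0..t} \<Longrightarrow> exp (\<mu> $ i * u) * (z u - \<rho> $ i) = c"
    using has_field_derivative_zero_constant[of "{0..t}" "\<lambda>u. exp (\<mu> $ i * u) * (z u - \<rho> $ i)"] by auto
  have "exp (\<mu> $ i * t) * (z t - \<rho> $ i) = y0 $ i - \<rho> $ i"
    using c[of t] c[of 0] z_eq[of 0] t by simp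
  then show ?thesis by (simp add: z_def exp_minus field_simps)
qed

definition V :: "real \<Rightarrow> real" where "V t = penalty \<beta> D h \<rho> (x t) (y t)"
abbreviation "gx i t \<equiv> grad_x \<beta> D h \<rho> i (x t) (y t)"
abbreviation "gy i t \<equiv> grad_y \<beta> D h \<rho> i (x t) (y t)"

text \<open>The derivative of the penalty along the trajectory. On the switching surface it does not
  depend on how arrivals are split, since there the two partial derivatives agree; this is why the
  minimum appears and why the nonuniqueness of \<open>\<alpha>\<close> is harmless.\<close>

definition drift :: "real \<Rightarrow> real" where
  "drift t = (\<Sum>i\<in>UNIV. lam $ i * min (gx i t) (gy i t) - \<mu> $ i * (gx i t * x t $ i + gy i t * y t $ i))"

lemma state_tendsto:
  assumes "0 \<le> t"
  shows "(x \<longlongrightarrow> x t) (at t within {0..})" "(y \<longlongrightarrow> y t) (at t within {0..})"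
  using cont assms by (auto simp: continuous_on_def intro!: vec_tendstoI)

text \<open>The trajectory need not have a right derivative, so the increment of the penalty over \<open>[t, r]\<close> is
  bounded by the tangent at the right end \<open>r\<close>, which is an exact inequality by convexity. Replacing
  the gradient at \<open>r\<close> by the one at \<open>t\<close> in the arrival terms costs the two absolute values in \<open>Q\<close>,
  and \<open>Q\<close> then depends on \<open>r\<close> only through quantities that converge to their values at \<open>t\<close>.\<close>

lemma V_decreasing:
  assumes t: "0 \<le> t" and drift: "drift t < 0"
  shows "\<forall>\<^sub>F r in at_right t. V r < V t"
proof -
  define ax where "ax i r = (integral {0..r} (\<lambda>u. x u $ i) - integral {0..t} (\<lambda>u. x u $ i)) / (r - t)" for i r
  define ay where "ay i r = (integral {0..r} (\<lambda>u. y u $ i) - integral {0..t} (\<lambda>u. y u $ i)) / (r - t)" for i r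
  define Q where "Q r = (\<Sum>i\<in>UNIV.
      lam $ i * (min (gx i t) (gy i t) + \<bar>gx i r - gx i t\<bar> + \<bar>gy i r - gy i t\<bar>)
      - \<mu> $ i * (gx i r * ax i r + gy i r * ay i r))" for r
  have right: "(x \<longlongrightarrow> x t) (at_right t)" "(y \<longlongrightarrow> y t) (at_right t)"
    using state_tendsto[OF t] t by (auto elim!: tendsto_within_subset)
  have g: "((\<lambda>r. gx i r) \<longlongrightarrow> gx i t) (at_right t)" "((\<lambda>r. gy i r) \<longlongrightarrow> gy i t) (at_right t)" for i
    by (intro tendsto_penalty_gradient right)+
  have av: "((\<lambda>r. ax i r) \<longlongrightarrow> x t $ i) (at_right t)" "((\<lambda>r. ay i r) \<longlongrightarrow> y t $ i) (at_right t)" for i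
    unfolding ax_def ay_def by (intro average_tendsto_right cont t)+
  have "(Q \<longlongrightarrow> (\<Sum>i\<in>UNIV.
      lam $ i * (min (gx i t) (gy i t) + \<bar>gx i t - gx i t\<bar> + \<bar>gy i t - gy i t\<bar>)
      - \<mu> $ i * (gx i t * x t $ i + gy i t * y t $ i))) (at_right t)"
    unfolding Q_def by (intro tendsto_intros g av)
  then have "(Q \<longlongrightarrow> drift t) (at_right t)" by (simp add: drift_def)
  then have Q: "\<forall>\<^sub>F r in at_right t. Q r < 0" using drift by (rule order_tendstoD)
  have split: "\<forall>\<^sub>F r in at_right t. \<forall>i. gx i t * (\<alpha> r $ i - \<alpha> t $ i) + gy i t * (r - t - (\<alpha> r $ i - \<alpha> t $ i))
      = (r - t) * min (gx i t) (gy i t)"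
  proof (rule eventually_all_finite)
    fix i
    consider "gx i t < gy i t" | "gy i t < gx i t" | "gx i t = gy i t" by linarith
    then show "\<forall>\<^sub>F r in at_right t. gx i t * (\<alpha> r $ i - \<alpha> t $ i) + gy i t * (r - t - (\<alpha> r $ i - \<alpha> t $ i))
      = (r - t) * min (gx i t) (gy i t)"
    proof cases
      case 1
      from accepting[OF t 1] show ?thesis by eventually_elim (use 1 in simp)
    next
      case 2
      from rejecting[OF t 2] show ?thesis by eventually_elim (use 2 in simp)
    next
      case 3
      then show ?thesis by (simp add: algebra_simps)
    qed
  qed
  from Q split eventually_at_right_less[of t] show ?thesis
  proof eventually_elim
    case (elim r)
    have r: "0 \<le> r" "t \<le> r" using elim t by auto
    have "V r - V t \<le> - (\<Sum>i\<in>UNIV. gx i r * (x t $ i - x r $ i) + gy i r * (y t $ i - y r $ i))"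
      using penalty_above_tangent[where x = "x r" and y = "y r" and x' = "x t" and y' = "y t" and \<beta> = \<beta> and D = D and h = h and \<rho> = \<rho>]
      by (simp add: V_def)
    also have "\<dots> = (\<Sum>i\<in>UNIV. gx i r * (x r $ i - x t $ i) + gy i r * (y r $ i - y t $ i))"
      by (simp add: sum_negf[symmetric] algebra_simps)
    also have "\<dots> \<le> (\<Sum>i\<in>UNIV. (r - t) * (
      lam $ i * (min (gx i t) (gy i t) + \<bar>gx i r - gx i t\<bar> + \<bar>gy i r - gy i t\<bar>)
      - \<mu> $ i * (gx i r * ax i r + gy i r * ay i r)))"
    proof (rule sum_mono)
      fix i
      let ?d = "\<alpha> r $ i - \<alpha> t $ i"
      have d: "0 \<le> ?d" "?d \<le> r - t" using \<alpha>_incr[of t r i] t r by auto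
      have ax: "(r - t) * ax i r = integral {0..r} (\<lambda>u. x u $ i) - integral {0..t} (\<lambda>u. x u $ i)"
        using elim(3) by (simp add: ax_def)
      have dx: "x r $ i - x t $ i = lam $ i * ?d - \<mu> $ i * ((r - t) * ax i r)"
        unfolding ax using x_eq[of r i] x_eq[of t i] t r by (simp add: right_diff_distrib)
      have ay: "(r - t) * ay i r = integral {0..r} (\<lambda>u. y u $ i) - integral {0..t} (\<lambda>u. y u $ i)"
        using elim(3) by (simp add: ay_def)
      have dy: "y r $ i - y t $ i = lam $ i * (r - t - ?d) - \<mu> $ i * ((r - t) * ay i r)"
        unfolding ay using y_eq[of r i] y_eq[of t i] t r by (simp add: right_diff_distrib)
      have "gx i r * ?d - gx i t * ?d \<le> \<bar>gx i r - gx i t\<bar> * (r - t)"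
        unfolding left_diff_distrib[symmetric] using d by (intro mult_mono) auto
      moreover have "gy i r * (r - t - ?d) - gy i t * (r - t - ?d) \<le> \<bar>gy i r - gy i t\<bar> * (r - t)"
        unfolding left_diff_distrib[symmetric] using d by (intro mult_mono) auto
      ultimately have "gx i r * ?d + gy i r * (r - t - ?d)
          \<le> (r - t) * min (gx i t) (gy i t) + \<bar>gx i r - gx i t\<bar> * (r - t) + \<bar>gy i r - gy i t\<bar> * (r - t)"
        using spec[OF elim(2), of i] by linarith
      then have "lam $ i * (gx i r * ?d + gy i r * (r - t - ?d))
          \<le> lam $ i * ((r - t) * min (gx i t) (gy i t) + \<bar>gx i r - gx i t\<bar> * (r - t) + \<bar>gy i r - gy i t\<bar> * (r - t))"
        using lam[of i] by (intro mult_left_mono) auto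
      then show "gx i r * (x r $ i - x t $ i) + gy i r * (y r $ i - y t $ i) \<le> (r - t) * (
          lam $ i * (min (gx i t) (gy i t) + \<bar>gx i r - gx i t\<bar> + \<bar>gy i r - gy i t\<bar>)
          - \<mu> $ i * (gx i r * ax i r + gy i r * ay i r))"
        unfolding dx dy by (simp add: algebra_simps)
    qed
    also have "\<dots> = (r - t) * Q r" by (simp add: Q_def sum_distrib_left)
    also have "\<dots> < 0" using elim by (intro mult_pos_neg) auto
    finally show ?case by simp
  qed
qed

text \<open>The policy sends each arrival where the penalty grows least, hence does no worse than splitting
  class \<open>i\<close> in the fixed proportions \<open>xs $ i\<close> to \<open>ys $ i\<close>. Bounding all service rates by \<open>m\<close> and \<open>M\<close>,
  the drift is at most \<open>m\<close> times the derivative of the penalty in the direction from the current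
  state to \<open>(M/m) (xs, ys)\<close>, and convexity bounds that by the difference of the two penalties.\<close>

lemma drift_negative:
  fixes xs ys :: "real ^ 'm"
  assumes t: "0 \<le> t" and grad: "\<And>i. 0 \<le> gx i t" "\<And>i. 0 \<le> gy i t"
    and xs: "\<And>i. 0 \<le> xs $ i" and ys: "\<And>i. 0 \<le> ys $ i" and sum: "\<And>i. xs $ i + ys $ i = \<rho> $ i"
    and m: "0 < m" "\<And>i. m \<le> \<mu> $ i" "\<And>i. \<mu> $ i \<le> M"
    and above: "penalty \<beta> D h \<rho> ((M / m) *\<^sub>R xs) ((M / m) *\<^sub>R ys) < V t"
  shows "drift t < 0"
proof -
  have "drift t \<le> (\<Sum>i\<in>UNIV. m * (gx i t * (((M / m) *\<^sub>R xs) $ i - x t $ i) + gy i t * (((M / m) *\<^sub>R ys) $ i - y t $ i)))"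
    unfolding drift_def
  proof (rule sum_mono)
    fix i
    have "\<mu> $ i * (xs $ i + ys $ i) = lam $ i" using \<rho>[of i] \<mu>[of i] sum[of i] by simp
    then have "lam $ i * min (gx i t) (gy i t) = \<mu> $ i * (xs $ i * min (gx i t) (gy i t) + ys $ i * min (gx i t) (gy i t))"
      by (metis distrib_right mult.assoc)
    also have "\<dots> \<le> \<mu> $ i * (xs $ i * gx i t + ys $ i * gy i t)"
      using \<mu>[of i] xs[of i] ys[of i] by (intro mult_left_mono add_mono) auto
    also have "\<dots> \<le> M * (xs $ i * gx i t + ys $ i * gy i t)"
      using m(3)[of i] xs[of i] ys[of i] grad[of i] by (intro mult_right_mono) auto
    finally have "lam $ i * min (gx i t) (gy i t) \<le> M * (xs $ i * gx i t + ys $ i * gy i t)" .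
    moreover have "m * (gx i t * x t $ i + gy i t * y t $ i) \<le> \<mu> $ i * (gx i t * x t $ i + gy i t * y t $ i)"
      using m(2)[of i] nonneg[OF t, of i] grad[of i] by (intro mult_right_mono) auto
    moreover have "m * (gx i t * (((M / m) *\<^sub>R xs) $ i - x t $ i) + gy i t * (((M / m) *\<^sub>R ys) $ i - y t $ i))
      = M * (xs $ i * gx i t + ys $ i * gy i t) - m * (gx i t * x t $ i + gy i t * y t $ i)"
      using m(1) by (simp add: field_simps)
    ultimately show "lam $ i * min (gx i t) (gy i t) - \<mu> $ i * (gx i t * x t $ i + gy i t * y t $ i)
      \<le> m * (gx i t * (((M / m) *\<^sub>R xs) $ i - x t $ i) + gy i t * (((M / m) *\<^sub>R ys) $ i - y t $ i))"
      by linarith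
  qed
  also have "\<dots> \<le> m * (penalty \<beta> D h \<rho> ((M / m) *\<^sub>R xs) ((M / m) *\<^sub>R ys) - V t)"
    unfolding sum_distrib_left[symmetric] V_def using m(1)
    by (intro mult_left_mono penalty_above_tangent) auto
  also have "\<dots> < 0" using m(1) above by (intro mult_pos_neg) auto
  finally show ?thesis .
qed

lemma penalty_bounded:
  fixes xs ys :: "real ^ 'm"
  assumes load: "\<And>j i. 0 \<le> load_x D h \<rho> j i" "\<And>j i. 0 \<le> load_y D h \<rho> j i" and \<beta>: "0 \<le> \<beta>"
    and xs: "\<And>i. 0 \<le> xs $ i" and ys: "\<And>i. 0 \<le> ys $ i" and sum: "\<And>i. xs $ i + ys $ i = \<rho> $ i"
    and m: "0 < m" "\<And>i. m \<le> \<mu> $ i" "\<And>i. \<mu> $ i \<le> M"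
    and K: "penalty \<beta> D h \<rho> ((M / m) *\<^sub>R xs) ((M / m) *\<^sub>R ys) \<le> K" "penalty \<beta> D h \<rho> 0 y0 \<le> K"
    and t: "0 \<le> t"
  shows "penalty \<beta> D h \<rho> (x t) (y t) \<le> K"
proof -
  have "V t \<le> K"
  proof (rule right_decreasing_above_level[OF _ _ _ t])
    show "continuous_on {0..} V"
      unfolding continuous_on_def V_def by (auto intro!: tendsto_penalty_gradient state_tendsto)
    have "x 0 = 0" "y 0 = y0" using x_eq[of 0] y_eq[of 0] \<alpha>_0 by (auto simp: vec_eq_iff)
    then show "V 0 \<le> K" using K(2) by (simp add: V_def)
    show "\<forall>\<^sub>F r in at_right u. V r < V u" if "0 \<le> u" "K < V u" for u
    proof (intro V_decreasing drift_negative[OF _ _ _ xs ys sum m])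
      show "0 \<le> gx i u" "0 \<le> gy i u" for i
        unfolding grad_x_def grad_y_def using load \<beta> by (auto intro!: sum_nonneg)
    qed (use that K in auto)
  qed
  then show ?thesis by (simp add: V_def)
qed

end

section \<open>Sample paths of the scaled models\<close>

lemma integral_between_0_and_1:
  fixes f :: "real \<Rightarrow> real"
  assumes f: "f integrable_on {0..t}" and st: "0 \<le> s" "s \<le> t"
  shows "(\<And>u. u \<in> {s..t} \<Longrightarrow> 0 \<le> f u) \<Longrightarrow> integral {0..s} f \<le> integral {0..t} f"
    and "(\<And>u. u \<in> {s..t} \<Longrightarrow> f u \<le> 1) \<Longrightarrow> integral {0..t} f - integral {0..s} f \<le> t - s"
    and "(\<And>u. u \<in> {s..t} \<Longrightarrow> f u = c) \<Longrightarrow> integral {0..t} f - integral {0..s} f = c * (t - s)"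
proof -
  have i: "f integrable_on {s..t}" using f st by (auto intro: integrable_on_subinterval)
  have split: "integral {0..s} f + integral {s..t} f = integral {0..t} f"
    using st f by (intro Henstock_Kurzweil_Integration.integral_combine) auto
  show "integral {0..s} f \<le> integral {0..t} f" if "\<And>u. u \<in> {s..t} \<Longrightarrow> 0 \<le> f u"
    using Henstock_Kurzweil_Integration.integral_nonneg[OF i that] split by simp
  have "integral {s..t} f \<le> integral {s..t} (\<lambda>_. 1)" if "\<And>u. u \<in> {s..t} \<Longrightarrow> f u \<le> 1"
    using i that by (intro integral_le) auto
  then show "integral {0..t} f - integral {0..s} f \<le> t - s" if "\<And>u. u \<in> {s..t} \<Longrightarrow> f u \<le> 1"
    using split st that by fastforce
  have "integral {s..t} f = integral {s..t} (\<lambda>_. c)" if "\<And>u. u \<in> {s..t} \<Longrightarrow> f u = c"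
    using that by (intro Henstock_Kurzweil_Integration.integral_cong) auto
  then show "integral {0..t} f - integral {0..s} f = c * (t - s)" if "\<And>u. u \<in> {s..t} \<Longrightarrow> f u = c"
    using split st that by (simp add: mult.commute)
qed

text \<open>One outcome of the random experiment for which all driving paths obey the law of large
  numbers and all models satisfy their balance equations.\<close>

locale sampled_models =
  fixes \<beta> :: real and D :: "real ^ 'm::finite ^ 's::finite" and h :: "real ^ 's"
    and \<rho> lam \<mu> y0 :: "real ^ 'm" and k :: "nat \<Rightarrow> nat ^ 'm"
    and P :: "system \<times> event \<times> 'm \<Rightarrow> real \<Rightarrow> nat"
    and X Y :: "nat \<Rightarrow> real \<Rightarrow> nat ^ 'm"
  assumes lam: "\<And>i. 0 < lam $ i" and \<mu>: "\<And>i. 0 < \<mu> $ i" and \<rho>: "\<And>i. \<rho> $ i = lam $ i / \<mu> $ i"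
    and P: "\<And>c. asymptotically_linear (P c)"
    and initial: "\<And>i. (\<lambda>n. real (k n $ i) / n) \<longlonglongrightarrow> y0 $ i"
    and path: "\<And>n. 1 \<le> n \<Longrightarrow> model_path \<beta> D h \<rho> lam \<mu> n (k n) P (X n) (Y n)"
begin

definition acc :: "nat \<Rightarrow> 'm \<Rightarrow> real \<Rightarrow> real" where
  "acc n i u = of_bool (accepts \<beta> D h \<rho> i (scale_state n (X n u)) (scale_state n (Y n u)))"

definition accept_time :: "nat \<Rightarrow> 'm \<Rightarrow> real \<Rightarrow> real" where
  "accept_time n i t = integral {0..t} (acc n i)"

lemma acc_bounds: "0 \<le> acc n i u" "acc n i u \<le> 1" by (auto simp: acc_def)

lemma path_dest:
  assumes "1 \<le> n" "0 \<le> t"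
  shows "acc n i integrable_on {0..t}"
    and "(\<lambda>u. real (X n u $ i)) integrable_on {0..t}" "(\<lambda>u. real (Y n u $ i)) integrable_on {0..t}"
    and "X n t $ i + P (Original, Departure, i) (integral {0..t} (\<lambda>u. \<mu> $ i * real (X n u $ i))) =
           P (Original, Arrival, i) (integral {0..t} (\<lambda>u. real n * lam $ i * acc n i u))"
    and "Y n t $ i + P (Fictitious, Departure, i) (integral {0..t} (\<lambda>u. \<mu> $ i * real (Y n u $ i))) =
           k n $ i + P (Fictitious, Arrival, i) (integral {0..t} (\<lambda>u. real n * lam $ i * (1 - acc n i u)))"
  using path[OF assms(1)] assms(2) unfolding model_path_def Let_def acc_def[abs_def] by blast+

lemma accept_time_incr:
  assumes "1 \<le> n" "0 \<le> s" "s \<le> t"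
  shows "accept_time n i s \<le> accept_time n i t" "accept_time n i t - accept_time n i s \<le> t - s"
  unfolding accept_time_def using assms path_dest(1)[OF assms(1)] acc_bounds
  by (auto intro!: integral_between_0_and_1)

lemma scaled_balance:
  fixes q a' c' k' :: nat and I n :: real
  assumes "q + a' = k' + c'"
  shows "real q / n + real a' / n = real k' / n + real c' / n"
  using assms by (metis add_divide_distrib of_nat_add)

lemma original_queue:
  "scaled_queues (P (Original, Arrival, i)) (P (Original, Departure, i))
    (\<lambda>n t. real (X n t $ i) / n) (\<lambda>n t. lam $ i * accept_time n i t) (\<lambda>_. 0) 0 (lam $ i) (\<mu> $ i)"
proof unfold_locales
  fix n :: nat and t :: real assume n: "1 \<le> n" and t: "0 \<le> t"
  show "(\<lambda>t. real (X n t $ i) / n) integrable_on {0..t}"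
    using path_dest(2)[OF n t] by (rule integrable_on_divide)
  have I: "integral {0..t} (\<lambda>u. \<mu> $ i * real (X n u $ i)) = real n * (\<mu> $ i * integral {0..t} (\<lambda>u. real (X n u $ i) / n))"
    using n by simp
  have A: "integral {0..t} (\<lambda>u. real n * lam $ i * acc n i u) = real n * (lam $ i * accept_time n i t)"
    by (simp add: accept_time_def)
  show "real (X n t $ i) / n + real (P (Original, Departure, i)
        (real n * (\<mu> $ i * integral {0..t} (\<lambda>u. real (X n u $ i) / n)))) / n
      = 0 + real (P (Original, Arrival, i) (real n * (lam $ i * accept_time n i t))) / n"
    using scaled_balance[of "X n t $ i" _ 0 _ "real n", unfolded add_0, OF path_dest(4)[OF n t, of i]]
    unfolding I A by simp
next
  fix n :: nat and s t :: real assume n: "1 \<le> n" and st: "0 \<le> s" "s \<le> t"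
  note incr = accept_time_incr[OF n st, of i]
  show "lam $ i * accept_time n i s \<le> lam $ i * accept_time n i t"
    using incr lam[of i] by (intro mult_left_mono) auto
  show "lam $ i * accept_time n i t - lam $ i * accept_time n i s \<le> lam $ i * (t - s)"
    unfolding right_diff_distrib[symmetric] using incr lam[of i] by (intro mult_left_mono) auto
qed (use P \<mu> lam[of i] in \<open>auto simp: accept_time_def\<close>)

lemma fictitious_queue:
  "scaled_queues (P (Fictitious, Arrival, i)) (P (Fictitious, Departure, i))
    (\<lambda>n t. real (Y n t $ i) / n) (\<lambda>n t. lam $ i * (t - accept_time n i t))
    (\<lambda>n. real (k n $ i) / n) (y0 $ i) (lam $ i) (\<mu> $ i)"
proof unfold_locales
  fix n :: nat and t :: real assume n: "1 \<le> n" and t: "0 \<le> t"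
  show "(\<lambda>t. real (Y n t $ i) / n) integrable_on {0..t}"
    using path_dest(3)[OF n t] by (rule integrable_on_divide)
  have I: "integral {0..t} (\<lambda>u. \<mu> $ i * real (Y n u $ i)) = real n * (\<mu> $ i * integral {0..t} (\<lambda>u. real (Y n u $ i) / n))"
    using n by simp
  have A: "integral {0..t} (\<lambda>u. real n * lam $ i * (1 - acc n i u)) = real n * (lam $ i * (t - accept_time n i t))"
  proof -
    have "integral {0..t} (\<lambda>u. 1 - acc n i u) = integral {0..t} (\<lambda>_. 1) - accept_time n i t"
      unfolding accept_time_def
      by (intro Henstock_Kurzweil_Integration.integral_diff integrable_const_ivl path_dest(1) n t)
    then show ?thesis using t by simp
  qed
  show "real (Y n t $ i) / n + real (P (Fictitious, Departure, i)
        (real n * (\<mu> $ i * integral {0..t} (\<lambda>u. real (Y n u $ i) / n)))) / n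
      = real (k n $ i) / n + real (P (Fictitious, Arrival, i) (real n * (lam $ i * (t - accept_time n i t)))) / n"
    using scaled_balance[where n = "real n", OF path_dest(5)[OF n t, of i]] unfolding I A .
next
  fix n :: nat and s t :: real assume n: "1 \<le> n" and st: "0 \<le> s" "s \<le> t"
  note incr = accept_time_incr[OF n st, of i]
  show "lam $ i * (s - accept_time n i s) \<le> lam $ i * (t - accept_time n i t)"
    using incr lam[of i] by (intro mult_left_mono) auto
  show "lam $ i * (t - accept_time n i t) - lam $ i * (s - accept_time n i s) \<le> lam $ i * (t - s)"
    unfolding right_diff_distrib[symmetric] using incr lam[of i] by (intro mult_left_mono) auto
qed (use P \<mu> lam[of i] initial in \<open>auto simp: accept_time_def\<close>)

sublocale orig: scaled_queues "P (Original, Arrival, i)" "P (Original, Departure, i)"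
    "\<lambda>n t. real (X n t $ i) / n" "\<lambda>n t. lam $ i * accept_time n i t" "\<lambda>_. 0" 0 "lam $ i" "\<mu> $ i" for i
  by (rule original_queue)

sublocale fict: scaled_queues "P (Fictitious, Arrival, i)" "P (Fictitious, Departure, i)"
    "\<lambda>n t. real (Y n t $ i) / n" "\<lambda>n t. lam $ i * (t - accept_time n i t)"
    "\<lambda>n. real (k n $ i) / n" "y0 $ i" "lam $ i" "\<mu> $ i" for i
  by (rule fictitious_queue)

text \<open>For a single outcome, convergence is available at countably many times only. The Lipschitz bounds
  tie the limit at the other times to these; they have to come from outside, by comparing
  different outcomes. The accepted time of the limit is read off
  the balance equation of the original system.\<close>

lemma fluid_limit_is_trajectory:
  fixes x y :: "real \<Rightarrow> real ^ 'm"
  assumes rat_x: "\<And>r i. r \<in> \<rat> \<Longrightarrow> 0 \<le> r \<Longrightarrow> (\<lambda>n. real (X n r $ i) / n) \<longlonglongrightarrow> x r $ i"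
    and rat_y: "\<And>r i. r \<in> \<rat> \<Longrightarrow> 0 \<le> r \<Longrightarrow> (\<lambda>n. real (Y n r $ i) / n) \<longlonglongrightarrow> y r $ i"
    and lip_x: "\<And>s t T i. 0 \<le> s \<Longrightarrow> s \<le> t \<Longrightarrow> t \<le> T \<Longrightarrow>
      \<bar>x t $ i - x s $ i\<bar> \<le> scaled_queues.lip 0 (lam $ i) (\<mu> $ i) T * (t - s)"
    and lip_y: "\<And>s t T i. 0 \<le> s \<Longrightarrow> s \<le> t \<Longrightarrow> t \<le> T \<Longrightarrow>
      \<bar>y t $ i - y s $ i\<bar> \<le> scaled_queues.lip (y0 $ i) (lam $ i) (\<mu> $ i) T * (t - s)"
  shows "\<exists>\<alpha>. fluid_trajectory \<beta> D h \<rho> lam \<mu> y0 x y \<alpha>"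
proof -
  have X: "(\<lambda>n. real (X n t $ i) / n) \<longlonglongrightarrow> x t $ i" if "0 \<le> t" for t i
    by (rule orig.limit_from_rationals[OF rat_x lip_x that])
  have Y: "(\<lambda>n. real (Y n t $ i) / n) \<longlonglongrightarrow> y t $ i" if "0 \<le> t" for t i
    by (rule fict.limit_from_rationals[OF rat_y lip_y that])
  define \<alpha> :: "real \<Rightarrow> real ^ 'm"
    where "\<alpha> t = (\<chi> i. (x t $ i + \<mu> $ i * integral {0..t} (\<lambda>u. x u $ i)) / lam $ i)" for t
  have \<alpha>: "(\<lambda>n. accept_time n i t) \<longlonglongrightarrow> \<alpha> t $ i" if "0 \<le> t" for t i
  proof -
    have "(\<lambda>n. lam $ i * accept_time n i t / lam $ i)
        \<longlonglongrightarrow> (x t $ i + \<mu> $ i * integral {0..t} (\<lambda>u. x u $ i) - 0) / lam $ i"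
      using lam[of i] by (intro tendsto_divide orig.arrivals_limit X that tendsto_const) auto
    then show ?thesis using lam[of i] by (simp add: \<alpha>_def)
  qed
  \<comment> \<open>the neighbourhoods of the finitely many coordinates are intersected\<close>
  have close: "\<exists>\<delta>>0. \<forall>\<^sub>F n in sequentially. \<forall>r\<in>{t..t + \<delta>}. \<forall>l.
      \<bar>real (X n r $ l) / n - x t $ l\<bar> < e \<and> \<bar>real (Y n r $ l) / n - y t $ l\<bar> < e"
    if t: "0 \<le> t" and e: "0 < e" for t e
  proof -
    have "\<forall>l. \<exists>d. 0 < d \<and> (\<forall>\<^sub>F n in sequentially. \<forall>r\<in>{t..t + d}. \<bar>real (X n r $ l) / n - x t $ l\<bar> < e)"
      using orig.eventually_close_to_limit[OF X[OF t] t e] by blast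
    from choice[OF this] obtain dx where dx: "\<And>l. 0 < dx l"
      "\<And>l. \<forall>\<^sub>F n in sequentially. \<forall>r\<in>{t..t + dx l}. \<bar>real (X n r $ l) / n - x t $ l\<bar> < e"
      by blast
    have "\<forall>l. \<exists>d. 0 < d \<and> (\<forall>\<^sub>F n in sequentially. \<forall>r\<in>{t..t + d}. \<bar>real (Y n r $ l) / n - y t $ l\<bar> < e)"
      using fict.eventually_close_to_limit[OF Y[OF t] t e] by blast
    from choice[OF this] obtain dy where dy: "\<And>l. 0 < dy l"
      "\<And>l. \<forall>\<^sub>F n in sequentially. \<forall>r\<in>{t..t + dy l}. \<bar>real (Y n r $ l) / n - y t $ l\<bar> < e"
      by blast
    define \<delta> where "\<delta> = Min (range dx \<union> range dy)"
    have \<delta>: "0 < \<delta>" "\<And>l. \<delta> \<le> dx l" "\<And>l. \<delta> \<le> dy l"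
      unfolding \<delta>_def using dx dy by auto
    have "\<forall>\<^sub>F n in sequentially. \<forall>l. (\<forall>r\<in>{t..t + dx l}. \<bar>real (X n r $ l) / n - x t $ l\<bar> < e)
        \<and> (\<forall>r\<in>{t..t + dy l}. \<bar>real (Y n r $ l) / n - y t $ l\<bar> < e)"
      by (intro eventually_all_finite eventually_conj dx dy)
    then have "\<forall>\<^sub>F n in sequentially. \<forall>r\<in>{t..t + \<delta>}. \<forall>l.
      \<bar>real (X n r $ l) / n - x t $ l\<bar> < e \<and> \<bar>real (Y n r $ l) / n - y t $ l\<bar> < e"
    proof eventually_elim
      case (elim n)
      show ?case
      proof (intro ballI allI)
        fix r l assume r: "r \<in> {t..t + \<delta>}"
        have "r \<in> {t..t + dx l}" "r \<in> {t..t + dy l}" using r \<delta>(2,3)[of l] by auto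
        then show "\<bar>real (X n r $ l) / n - x t $ l\<bar> < e \<and> \<bar>real (Y n r $ l) / n - y t $ l\<bar> < e"
          using elim by blast
      qed
    qed
    with \<delta>(1) show ?thesis by blast
  qed
  \<comment> \<open>a routing decision that is constant near the limit state is shared by all late models on a
    common time interval, and so passes to the limit\<close>
  have switch: "\<forall>\<^sub>F r in at_right t. \<alpha> r $ i - \<alpha> t $ i = c * (r - t)"
    if t: "0 \<le> t" and e: "0 < e"
      and const: "\<And>n r. (\<And>l. \<bar>scale_state n (X n r) $ l - x t $ l\<bar> < e \<and> \<bar>scale_state n (Y n r) $ l - y t $ l\<bar> < e)
        \<Longrightarrow> acc n i r = c" for t i e c
  proof -
    obtain \<delta> where \<delta>: "0 < \<delta>" and ev: "\<forall>\<^sub>F n in sequentially. \<forall>r\<in>{t..t + \<delta>}. \<forall>l.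
      \<bar>real (X n r $ l) / n - x t $ l\<bar> < e \<and> \<bar>real (Y n r $ l) / n - y t $ l\<bar> < e"
      using close[OF t e] by blast
    have "\<alpha> r $ i - \<alpha> t $ i = c * (r - t)" if r: "t < r" "r < t + \<delta>" for r
    proof (rule LIMSEQ_unique)
      show "(\<lambda>n. accept_time n i r - accept_time n i t) \<longlonglongrightarrow> \<alpha> r $ i - \<alpha> t $ i"
        using r t by (intro tendsto_diff \<alpha>) auto
      have "\<forall>\<^sub>F n in sequentially. accept_time n i r - accept_time n i t = c * (r - t)"
        using ev eventually_ge_at_top[of 1]
      proof eventually_elim
        case (elim n)
        have "acc n i u = c" if "u \<in> {t..r}" for u
          using elim(1) that r by (intro const) (auto simp: scale_state_def)
        then show ?case
          unfolding accept_time_def using path_dest(1)[OF elim(2), of r] t r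
          by (intro integral_between_0_and_1(3)) auto
      qed
      then show "(\<lambda>n. accept_time n i r - accept_time n i t) \<longlonglongrightarrow> c * (r - t)"
        by (rule tendsto_eventually)
    qed
    moreover have "\<forall>\<^sub>F r in at_right t. t < r \<and> r < t + \<delta>"
      using eventually_at_right_less eventually_at_right_real[of t "t + \<delta>"] \<delta>
      by (auto elim: eventually_elim2)
    ultimately show ?thesis by (auto elim: eventually_mono)
  qed
  have "fluid_trajectory \<beta> D h \<rho> lam \<mu> y0 x y \<alpha>"
  proof
    show "0 < lam $ i" "0 < \<mu> $ i" "\<rho> $ i = lam $ i / \<mu> $ i" for i by (rule lam \<mu> \<rho>)+
    show "0 \<le> x t $ i" "0 \<le> y t $ i" if "0 \<le> t" for t i
      by (rule LIMSEQ_le_const[OF X[OF that]] LIMSEQ_le_const[OF Y[OF that]], simp)+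
    show "continuous_on {0..} (\<lambda>t. x t $ i)" "continuous_on {0..} (\<lambda>t. y t $ i)" for i
      by (rule orig.limit_continuous[OF lip_x] fict.limit_continuous[OF lip_y]; assumption)+
    show "x t $ i = lam $ i * \<alpha> t $ i - \<mu> $ i * integral {0..t} (\<lambda>u. x u $ i)" if "0 \<le> t" for t i
      using lam[of i] by (simp add: \<alpha>_def)
    show "y t $ i = y0 $ i + lam $ i * (t - \<alpha> t $ i) - \<mu> $ i * integral {0..t} (\<lambda>u. y u $ i)" if "0 \<le> t" for t i
    proof -
      have "(\<lambda>n. lam $ i * (t - accept_time n i t)) \<longlonglongrightarrow> y t $ i + \<mu> $ i * integral {0..t} (\<lambda>u. y u $ i) - y0 $ i"
        by (intro fict.arrivals_limit Y that)
      moreover have "(\<lambda>n. lam $ i * (t - accept_time n i t)) \<longlonglongrightarrow> lam $ i * (t - \<alpha> t $ i)"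
        by (intro tendsto_intros \<alpha> that)
      ultimately show ?thesis using LIMSEQ_unique by fastforce
    qed
    show "\<alpha> 0 $ i = 0" for i
      using \<alpha>[of 0 i] by (simp add: accept_time_def LIMSEQ_const_iff)
    show "0 \<le> \<alpha> t $ i - \<alpha> s $ i \<and> \<alpha> t $ i - \<alpha> s $ i \<le> t - s" if "0 \<le> s" "s \<le> t" for s t i
    proof
      have lim: "(\<lambda>n. accept_time n i t - accept_time n i s) \<longlonglongrightarrow> \<alpha> t $ i - \<alpha> s $ i"
        using that by (intro tendsto_diff \<alpha>) auto
      show "0 \<le> \<alpha> t $ i - \<alpha> s $ i"
        by (rule LIMSEQ_le_const[OF lim]) (use accept_time_incr(1)[OF _ that, of _ i] in \<open>auto intro!: exI[of _ 1]\<close>)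
      show "\<alpha> t $ i - \<alpha> s $ i \<le> t - s"
        by (rule LIMSEQ_le_const2[OF lim]) (use accept_time_incr(2)[OF _ that, of _ i] in \<open>auto intro!: exI[of _ 1]\<close>)
    qed
    show "\<forall>\<^sub>F r in at_right t. \<alpha> r $ i - \<alpha> t $ i = r - t"
      if t: "0 \<le> t" and less: "grad_x \<beta> D h \<rho> i (x t) (y t) < grad_y \<beta> D h \<rho> i (x t) (y t)" for t i
    proof -
      obtain e where "0 < e" and e: "\<And>x' y'. (\<forall>l. \<bar>x' $ l - x t $ l\<bar> < e \<and> \<bar>y' $ l - y t $ l\<bar> < e) \<Longrightarrow>
          grad_x \<beta> D h \<rho> i x' y' < grad_y \<beta> D h \<rho> i x' y'"
        using grad_less_nearby(1)[OF less] by blast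
      have "\<forall>\<^sub>F r in at_right t. \<alpha> r $ i - \<alpha> t $ i = 1 * (r - t)"
        by (rule switch[OF t \<open>0 < e\<close>]) (auto simp: acc_def accepts_iff intro!: less_imp_le e)
      then show ?thesis by simp
    qed
    show "\<forall>\<^sub>F r in at_right t. \<alpha> r $ i - \<alpha> t $ i = 0"
      if t: "0 \<le> t" and less: "grad_y \<beta> D h \<rho> i (x t) (y t) < grad_x \<beta> D h \<rho> i (x t) (y t)" for t i
    proof -
      obtain e where "0 < e" and e: "\<And>x' y'. (\<forall>l. \<bar>x' $ l - x t $ l\<bar> < e \<and> \<bar>y' $ l - y t $ l\<bar> < e) \<Longrightarrow>
          grad_y \<beta> D h \<rho> i x' y' < grad_x \<beta> D h \<rho> i x' y'"
        using grad_less_nearby(2)[OF less] by blast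
      have "\<forall>\<^sub>F r in at_right t. \<alpha> r $ i - \<alpha> t $ i = 0 * (r - t)"
        by (rule switch[OF t \<open>0 < e\<close>]) (auto simp: acc_def accepts_iff not_le intro!: e)
      then show ?thesis by simp
    qed
  qed
  then show ?thesis by blast
qed

end

section \<open>Exponentials of diagonal matrices\<close>

lemma diag_mat_mult: "diag_mat u ** diag_mat v = diag_mat (\<chi> i. u $ i * v $ i)"
  by (simp add: diag_mat_def matrix_matrix_mult_def vec_eq_iff if_distrib[of "\<lambda>z. z * _"] cong: if_cong)

lemma mat_power_diag_mat: "mat_power (diag_mat v) n = diag_mat (\<chi> i. v $ i ^ n)"
proof (induction n)
  case 0
  show ?case by (simp add: mat_def diag_mat_def vec_eq_iff)
next
  case (Suc n)
  then show ?case by (simp add: diag_mat_mult)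
qed

lemma mat_exp_diag_mat: "mat_exp (diag_mat v) = diag_mat (\<chi> i. exp (v $ i))"
proof -
  have "(\<lambda>k. (1 / fact k) *\<^sub>R mat_power (diag_mat v) k) sums diag_mat (\<chi> i. exp (v $ i))"
    unfolding sums_def
  proof (intro vec_tendstoI)
    fix i j
    have "(\<lambda>k. v $ i ^ k / fact k) sums exp (v $ i)"
      using exp_converges[of "v $ i"] by (simp add: scaleR_conv_of_real field_simps)
    then show "((\<lambda>n. (\<Sum>k<n. (1 / fact k) *\<^sub>R mat_power (diag_mat v) k) $ i $ j) \<longlongrightarrow> diag_mat (\<chi> i. exp (v $ i)) $ i $ j) sequentially"
      unfolding mat_power_diag_mat by (cases "i = j") (simp_all add: diag_mat_def sums_def)
  qed
  then show ?thesis unfolding mat_exp_def by (rule sums_unique[symmetric])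
qed

lemma mat_exp_scaled_diag_mat_mult:
  "mat_exp (r *\<^sub>R diag_mat v) *v w = (\<chi> i. exp (r * v $ i) * w $ i)"
proof -
  have "r *\<^sub>R diag_mat v = diag_mat (\<chi> i. r * v $ i)"
    by (simp add: diag_mat_def vec_eq_iff)
  then show ?thesis
    by (simp add: mat_exp_diag_mat)
      (simp add: diag_mat_def matrix_vector_mult_def vec_eq_iff if_distrib[of "\<lambda>z. z * _"] cong: if_cong)
qed

section \<open>From the penalty bound to the relaxed polytope\<close>

lemma pos_mat_minus_neg_mat: "pos_mat D $ j $ i - neg_mat D $ j $ i = D $ j $ i"
  by (simp add: pos_mat_def neg_mat_def)

lemma mat_nonneg: "0 \<le> pos_mat D $ j $ i" "0 \<le> neg_mat D $ j $ i"
  by (simp_all add: pos_mat_def neg_mat_def)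

text \<open>The load of the original system is that of the joint state minus a contribution of the total
  only, because \<open>D = D\<^sup>+ - D\<^sup>-\<close>.\<close>

lemma mult_minus_neg_mat:
  "(D *v x) $ j = (pos_mat D *v x) $ j + (neg_mat D *v y) $ j - (neg_mat D *v (x + y)) $ j"
  unfolding pos_mat_minus_neg_mat[of D, symmetric] matrix_vector_mult_def
  by (simp add: sum.distrib sum_subtractf algebra_simps)

text \<open>A strictly feasible \<open>x\<close> makes all normalizing denominators positive: in the lifted constraint for
  \<open>(x, \<rho> - x)\<close> the left-hand side is nonnegative and strictly below the right-hand side.\<close>

lemma capacity_pos:
  assumes "x \<in> target_polytope D h \<rho>" "(D *v x) $ j < h $ j"
  shows "0 < h $ j + (neg_mat D *v \<rho>) $ j"
proof -
  have x: "0 \<le> x $ i" "x $ i \<le> \<rho> $ i" for i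
    using assms(1) by (auto simp: target_polytope_def less_eq_vec_def)
  have "0 \<le> (pos_mat D *v x) $ j + (neg_mat D *v (\<rho> - x)) $ j"
    unfolding matrix_vector_mult_def using x
    by (auto intro!: add_nonneg_nonneg sum_nonneg mult_nonneg_nonneg mat_nonneg)
  then show ?thesis using mult_minus_neg_mat[of D x j "\<rho> - x"] assms(2) by simp
qed

lemma penalty_mono_loads:
  assumes "0 \<le> \<beta>" "\<And>j. norm_load D h \<rho> j x y \<le> norm_load D h \<rho> j x' y'"
  shows "penalty \<beta> D h \<rho> x y \<le> penalty \<beta> D h \<rho> x' y'"
  unfolding penalty_def using assms by (intro sum_mono) (simp add: mult_left_mono)

text \<open>Replacing the maximum of the loads by a sum of exponentials loses at most the logarithm of the
  number of constraints divided by \<open>\<beta>\<close>.\<close>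

lemma load_le_of_penalty_le:
  fixes D :: "real ^ 'm::finite ^ 's::finite"
  assumes pen: "penalty \<beta> D h \<rho> x y \<le> penalty \<beta> D h \<rho> x' y'"
    and \<beta>: "0 < \<beta>" and le: "\<And>j. norm_load D h \<rho> j x' y' \<le> B"
  shows "norm_load D h \<rho> j x y \<le> B + ln (real CARD('s)) / \<beta>"
proof -
  have "exp (\<beta> * norm_load D h \<rho> j x y) \<le> penalty \<beta> D h \<rho> x y"
    unfolding penalty_def by (rule member_le_sum) auto
  also have "\<dots> \<le> (\<Sum>j\<in>(UNIV :: 's set). exp (\<beta> * B))"
    using pen unfolding penalty_def
    by (rule order_trans) (intro sum_mono, use le \<beta> in auto)
  also have "\<dots> = exp (\<beta> * B + ln (real CARD('s)))" by (simp add: exp_add)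
  finally have "\<beta> * norm_load D h \<rho> j x y \<le> \<beta> * B + ln (real CARD('s))" by simp
  then show ?thesis using \<beta> by (simp add: field_simps)
qed

theorem theorem10:
  fixes M :: "'w measure"
    and N :: "system \<times> event \<times> 'm::finite \<Rightarrow> real \<Rightarrow> 'w \<Rightarrow> nat"
    and X Y :: "nat \<Rightarrow> real \<Rightarrow> 'w \<Rightarrow> nat ^ 'm"
    and k :: "nat \<Rightarrow> nat ^ 'm"
    and D :: "real ^ 'm ^ 's::finite" and h :: "real ^ 's"
    and lam \<mu> \<rho> xs ys y0 :: "real ^ 'm"
    and \<mu>min \<mu>max \<gamma> \<epsilon> \<beta> :: real
    and xinf yinf :: "real \<Rightarrow> real ^ 'm"
  assumes rates: "\<And>i. lam $ i > 0" "\<And>i. \<mu> $ i > 0"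
    and rho: "\<rho> = (\<chi> i. lam $ i / \<mu> $ i)"
    and h_nonneg: "0 \<le> h"
    and interior: "\<exists>x \<in> target_polytope D h \<rho>. \<forall>j. (D *v x) $ j < h $ j"
    and mu_min: "\<mu>min = (MIN i\<in>UNIV. \<mu> $ i)"
    and mu_max: "\<mu>max = (MAX i\<in>UNIV. \<mu> $ i)"
    and minimizer: "lifted_minimizer D h \<rho> (xs, ys)"
    and gamma: "\<gamma> = max_load D h \<rho> (xs, ys)"
    and rate_ratio: "\<mu>min / \<mu>max \<ge> \<gamma>"
    and eps: "0 < \<epsilon>" "\<epsilon> < 1 / 4"
    and beta: "0 < \<beta>" "\<beta> \<ge> 1 / \<epsilon> * ln (real CARD('s))"
    and initial_penalty: "penalty \<beta> D h \<rho> 0 y0 \<le>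
      penalty \<beta> D h \<rho> (((1 + 3 * \<epsilon>) * \<mu>max / \<mu>min) *\<^sub>R xs) (((1 + 3 * \<epsilon>) * \<mu>max / \<mu>min) *\<^sub>R ys)"
    and prob: "prob_space M"
    and poisson: "prob_space.indep_unit_poisson_family M N"
    and initial_state: "(\<lambda>n. scale_state n (k n)) \<longlonglongrightarrow> y0"
    and models: "\<And>n. n \<ge> 1 \<Longrightarrow> AE \<omega> in M.
      model_path \<beta> D h \<rho> lam \<mu> n (k n) (\<lambda>c t. N c t \<omega>) (\<lambda>t. X n t \<omega>) (\<lambda>t. Y n t \<omega>)"
    and limit_x: "\<And>t. t \<ge> 0 \<Longrightarrow> AE \<omega> in M. (\<lambda>n. scale_state n (X n t \<omega>)) \<longlonglongrightarrow> xinf t"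
    and limit_y: "\<And>t. t \<ge> 0 \<Longrightarrow> AE \<omega> in M. (\<lambda>n. scale_state n (Y n t \<omega>)) \<longlonglongrightarrow> yinf t"
  shows "\<forall>t\<ge>0. xinf t \<in> relaxed_set D h \<rho> \<mu> \<epsilon> y0 t"
proof -
  interpret prob_space M by (rule prob)
  have \<rho>: "\<rho> $ i = lam $ i / \<mu> $ i" for i by (simp add: rho)
  have AE_good: "AE \<omega> in M. sampled_models \<beta> D h \<rho> lam \<mu> y0 k (\<lambda>c t. N c t \<omega>) (\<lambda>n t. X n t \<omega>) (\<lambda>n t. Y n t \<omega>)"
  proof -
    have "AE \<omega> in M. \<forall>c\<in>UNIV. asymptotically_linear (\<lambda>t. N c t \<omega>)"
    proof (rule AE_finite_allI)
      have "(UNIV :: system set) = {Original, Fictitious}" "(UNIV :: event set) = {Arrival, Departure}"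
        using system.exhaust event.exhaust by blast+
      then have "finite (UNIV :: system set)" "finite (UNIV :: event set)"
        by (metis finite.emptyI finite.insertI)+
      then show "finite (UNIV :: (system \<times> event \<times> 'm) set)" by (intro finite_Prod_UNIV finite)
      show "AE \<omega> in M. asymptotically_linear (\<lambda>t. N c t \<omega>)" for c
        using poisson unfolding indep_unit_poisson_family_def by (intro AE_asymptotically_linear) blast
    qed
    moreover have "AE \<omega> in M. \<forall>n. 1 \<le> n \<longrightarrow>
        model_path \<beta> D h \<rho> lam \<mu> n (k n) (\<lambda>c t. N c t \<omega>) (\<lambda>t. X n t \<omega>) (\<lambda>t. Y n t \<omega>)"
      unfolding AE_all_countable using models by (auto intro: AE_impI)
    ultimately show ?thesis
    proof eventually_elim
      case (elim \<omega>)
      show ?case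
      proof
        show "(\<lambda>n. real (k n $ i) / real n) \<longlonglongrightarrow> y0 $ i" for i
          using tendsto_vec_nth[OF initial_state, of i] by (simp add: scale_state_def)
      qed (use elim rates \<rho> in auto)
    qed
  qed
  \<comment> \<open>the null set depends on the times considered, so only countably many are treated at once\<close>
  have sample: "\<exists>P X Y. sampled_models \<beta> D h \<rho> lam \<mu> y0 k P X Y \<and>
      (\<forall>t\<in>S. \<forall>i. (\<lambda>n. real (X n t $ i) / n) \<longlonglongrightarrow> xinf t $ i \<and> (\<lambda>n. real (Y n t $ i) / n) \<longlonglongrightarrow> yinf t $ i)"
    if S: "countable S" "S \<subseteq> {0..}" for S
  proof -
    have "AE \<omega> in M. \<forall>t\<in>S. (\<lambda>n. scale_state n (X n t \<omega>)) \<longlonglongrightarrow> xinf t \<and> (\<lambda>n. scale_state n (Y n t \<omega>)) \<longlonglongrightarrow> yinf t"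
      unfolding AE_ball_countable[OF S(1)] using S(2) limit_x limit_y by (intro ballI AE_conjI) auto
    with AE_good have "AE \<omega> in M. sampled_models \<beta> D h \<rho> lam \<mu> y0 k (\<lambda>c t. N c t \<omega>) (\<lambda>n t. X n t \<omega>) (\<lambda>n t. Y n t \<omega>) \<and>
      (\<forall>t\<in>S. (\<lambda>n. scale_state n (X n t \<omega>)) \<longlonglongrightarrow> xinf t \<and> (\<lambda>n. scale_state n (Y n t \<omega>)) \<longlonglongrightarrow> yinf t)"
      by (rule AE_conjI)
    from eventually_happens'[OF ae_filter_bot this] obtain \<omega> where \<omega>: "sampled_models \<beta> D h \<rho> lam \<mu> y0 k (\<lambda>c t. N c t \<omega>) (\<lambda>n t. X n t \<omega>) (\<lambda>n t. Y n t \<omega>)"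
      "\<And>t. t \<in> S \<Longrightarrow> (\<lambda>n. scale_state n (X n t \<omega>)) \<longlonglongrightarrow> xinf t"
      "\<And>t. t \<in> S \<Longrightarrow> (\<lambda>n. scale_state n (Y n t \<omega>)) \<longlonglongrightarrow> yinf t"
      by blast
    have "(\<lambda>n. real (X n t \<omega> $ i) / n) \<longlonglongrightarrow> xinf t $ i" "(\<lambda>n. real (Y n t \<omega> $ i) / n) \<longlonglongrightarrow> yinf t $ i" if "t \<in> S" for t i
      using tendsto_vec_nth[OF \<omega>(2)[OF that], of i] tendsto_vec_nth[OF \<omega>(3)[OF that], of i]
      by (simp_all add: scale_state_def)
    with \<omega>(1) show ?thesis by blast
  qed
  have lip: "\<bar>xinf t $ i - xinf s $ i\<bar> \<le> scaled_queues.lip 0 (lam $ i) (\<mu> $ i) T * (t - s)"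
    "\<bar>yinf t $ i - yinf s $ i\<bar> \<le> scaled_queues.lip (y0 $ i) (lam $ i) (\<mu> $ i) T * (t - s)"
    if st: "0 \<le> s" "s \<le> t" "t \<le> T" for s t T i
  proof -
    obtain P X' Y' where s: "sampled_models \<beta> D h \<rho> lam \<mu> y0 k P X' Y'"
      and lim: "\<forall>t\<in>{s, t}. \<forall>i. (\<lambda>n. real (X' n t $ i) / n) \<longlonglongrightarrow> xinf t $ i \<and> (\<lambda>n. real (Y' n t $ i) / n) \<longlonglongrightarrow> yinf t $ i"
      using sample[of "{s, t}"] st by auto
    interpret sampled_models \<beta> D h \<rho> lam \<mu> y0 k P X' Y' by (rule s)
    show "\<bar>xinf t $ i - xinf s $ i\<bar> \<le> scaled_queues.lip 0 (lam $ i) (\<mu> $ i) T * (t - s)"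
      by (rule orig.limit_increment[OF st]) (use lim in auto)
    show "\<bar>yinf t $ i - yinf s $ i\<bar> \<le> scaled_queues.lip (y0 $ i) (lam $ i) (\<mu> $ i) T * (t - s)"
      by (rule fict.limit_increment[OF st]) (use lim in auto)
  qed
  have "countable (\<rat> \<inter> {0..} :: real set)" using countable_rat by (rule countable_Int1)
  then obtain P X' Y' where s: "sampled_models \<beta> D h \<rho> lam \<mu> y0 k P X' Y'"
    and lim: "\<forall>t\<in>\<rat> \<inter> {0..}. \<forall>i. (\<lambda>n. real (X' n t $ i) / n) \<longlonglongrightarrow> xinf t $ i \<and> (\<lambda>n. real (Y' n t $ i) / n) \<longlonglongrightarrow> yinf t $ i"
    using sample[of "\<rat> \<inter> {0..}"] by auto
  obtain \<alpha> where fluid: "fluid_trajectory \<beta> D h \<rho> lam \<mu> y0 xinf yinf \<alpha>"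
    using sampled_models.fluid_limit_is_trajectory[OF s _ _ lip] lim by auto
  interpret fluid: fluid_trajectory \<beta> D h \<rho> lam \<mu> y0 xinf yinf \<alpha> by (rule fluid)

  have \<mu>_bounds: "0 < \<mu>min" "\<mu>min \<le> \<mu> $ i" "\<mu> $ i \<le> \<mu>max" "0 < \<mu>max" for i
  proof -
    show *: "0 < \<mu>min" "\<mu>min \<le> \<mu> $ i" "\<mu> $ i \<le> \<mu>max" for i unfolding mu_min mu_max using rates by auto
    show "0 < \<mu>max" using rates(2)[of i] *(3)[of i] by linarith
  qed
  have "(xs, ys) \<in> lifted_set D h \<rho>" and sum: "xs + ys = \<rho>"
    using minimizer by (auto simp: lifted_minimizer_def is_arg_min_def)
  then have xs: "0 \<le> xs $ i" and ys: "0 \<le> ys $ i" for i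
    by (auto simp: lifted_set_def less_eq_vec_def)
  have cap: "0 < h $ j + (neg_mat D *v \<rho>) $ j" for j
    using interior capacity_pos by blast
  have load: "0 \<le> load_x D h \<rho> j i" "0 \<le> load_y D h \<rho> j i" for j i
    unfolding load_x_def load_y_def using cap[of j] by (auto intro!: divide_nonneg_pos mat_nonneg)
  have load_s: "0 \<le> norm_load D h \<rho> j xs ys" "norm_load D h \<rho> j xs ys \<le> \<gamma>" for j
    unfolding norm_load_eq_sum gamma max_load_def using load xs ys
    by (auto intro!: sum_nonneg Max_ge simp: norm_load_eq_sum)
  define c where "c = \<mu>max / \<mu>min"
  have c: "0 < c" using \<mu>_bounds by (simp add: c_def)
  have c\<gamma>: "c * \<gamma> \<le> 1" using rate_ratio \<mu>_bounds by (simp add: c_def field_simps)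
  \<comment> \<open>the factor by which the minimizer is scaled in the initial penalty\<close>
  define B where "B = (1 + 3 * \<epsilon>) * c"
  have B: "(1 + 3 * \<epsilon>) * \<mu>max / \<mu>min = B" by (simp add: B_def c_def)
  \<comment> \<open>scaling by \<open>B \<ge> c\<close> only increases the loads, so the penalty decreases above this level\<close>
  have pen: "penalty \<beta> D h \<rho> (xinf t) (yinf t) \<le> penalty \<beta> D h \<rho> (B *\<^sub>R xs) (B *\<^sub>R ys)" if "0 \<le> t" for t
  proof (rule fluid.penalty_bounded[OF load _ xs ys _ _ _ _ _ _ that])
    show "xs $ i + ys $ i = \<rho> $ i" for i using sum by (auto simp: vec_eq_iff)
    show "penalty \<beta> D h \<rho> ((\<mu>max / \<mu>min) *\<^sub>R xs) ((\<mu>max / \<mu>min) *\<^sub>R ys) \<le> penalty \<beta> D h \<rho> (B *\<^sub>R xs) (B *\<^sub>R ys)"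
    proof (rule penalty_mono_loads)
      have "c \<le> B" using eps c by (simp add: B_def)
      then show "norm_load D h \<rho> j ((\<mu>max / \<mu>min) *\<^sub>R xs) ((\<mu>max / \<mu>min) *\<^sub>R ys)
          \<le> norm_load D h \<rho> j (B *\<^sub>R xs) (B *\<^sub>R ys)" for j
        unfolding norm_load_scaleR c_def[symmetric] by (rule mult_right_mono[OF _ load_s(1)])
    qed (use beta in simp)
    show "penalty \<beta> D h \<rho> 0 y0 \<le> penalty \<beta> D h \<rho> (B *\<^sub>R xs) (B *\<^sub>R ys)"
      using initial_penalty unfolding B .
  qed (use \<mu>_bounds beta in auto)
  have loads: "norm_load D h \<rho> j (xinf t) (yinf t) \<le> 1 + 4 * \<epsilon>" if "0 \<le> t" for j t
  proof -
    have "norm_load D h \<rho> j (B *\<^sub>R xs) (B *\<^sub>R ys) \<le> 1 + 3 * \<epsilon>" for j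
    proof -
      have "c * norm_load D h \<rho> j xs ys \<le> c * \<gamma>" using load_s(2) c by (intro mult_left_mono) auto
      then have "(1 + 3 * \<epsilon>) * (c * norm_load D h \<rho> j xs ys) \<le> (1 + 3 * \<epsilon>) * 1"
        using c\<gamma> eps by (intro mult_left_mono) auto
      then show ?thesis by (simp add: norm_load_scaleR B_def mult.assoc)
    qed
    then have "norm_load D h \<rho> j (xinf t) (yinf t) \<le> 1 + 3 * \<epsilon> + ln (real CARD('s)) / \<beta>"
      by (intro load_le_of_penalty_le[OF pen[OF that] beta(1)])
    moreover have "ln (real CARD('s)) / \<beta> \<le> \<epsilon>"
      using beta eps by (simp add: field_simps)
    ultimately show ?thesis by linarith
  qed
  show ?thesis
  proof (intro allI impI)
    fix t :: real assume t: "0 \<le> t"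
    have "(D *v xinf t) $ j \<le> h $ j + 4 * \<epsilon> * (h $ j + (neg_mat D *v \<rho>) $ j)
        + (neg_mat D *v (mat_exp (- t *\<^sub>R diag_mat \<mu>) *v (\<rho> - y0))) $ j" for j
    proof -
      have total: "xinf t + yinf t = \<rho> - mat_exp (- t *\<^sub>R diag_mat \<mu>) *v (\<rho> - y0)"
        unfolding mat_exp_scaled_diag_mat_mult using fluid.total_eq[OF t] by (simp add: vec_eq_iff mult.commute)
      have "(pos_mat D *v xinf t) $ j + (neg_mat D *v yinf t) $ j \<le> (1 + 4 * \<epsilon>) * (h $ j + (neg_mat D *v \<rho>) $ j)"
        using loads[OF t, of j] cap[of j] by (simp add: norm_load_def divide_le_eq)
      then show ?thesis
        using mult_minus_neg_mat[of D "xinf t" j "yinf t"] unfolding total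
        by (simp add: matrix_vector_mult_diff_distrib algebra_simps)
    qed
    then show "xinf t \<in> relaxed_set D h \<rho> \<mu> \<epsilon> y0 t"
      using fluid.nonneg(1)[OF t] fluid.x_le_\<rho>[OF t]
      by (auto simp: relaxed_set_def less_eq_vec_def)
  qed
qed

end
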